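(* Let $\mathbb{K}$ be a field of characteristic zero, let $n=k+1$, let $\lambda\vdash n$, $\mu\vdash k$ with $\mu\subset\lambda$, let $T$ be a Young tableau of shape $\lambda$ with entries $1,\dots,n$, and let $S$ be its Young subtableau of shape $\mu$. Suppose the unique entry of $T$ not in $S$ is $a$, located in position $(u,v)$, so $\lambda_i=\mu_i$ for $i\neq u$ and $\lambda_u=v=\mu_u+1$. Let $\tilde S$ be the tableau obtained from $S$ by removing its first $v$ columns (its shape $\tilde\mu$ has $\tilde\mu_i=\mu_i-v$ for $i<u$ and $\tilde\mu_i=0$ otherwise). Divide $\tilde S$ into blocks $\tilde B_1,\dots,\tilde B_{\tilde m}$, listed from left to right, where each block is a maximal set of consecutive columns of $\tilde S$ having the same size; let $\tilde l_i$ be the number of columns of $\tilde B_i$ and $\tilde h_i$ the common size of these columns. Set $\tilde r_i=\tilde l_1+\cdots+\tilde l_i+u-\tilde h_i$ (the length of the hook of $\mu$ centered at $(\tilde h_i,v)$) and $\tilde x_i=\sum_{b\in\tilde B_i}(a,b)\in\mathbb{K}[\mathfrak{S}_n]$. Then \[\mathfrak{c}_\lambda(T)\cdot\mathfrak{c}_\mu(S)=\mathfrak{c}_\lambda(T)\cdot\alpha_\mu\cdot\prod_{i=1}^{\tilde m}\Big(1-\frac{\tilde x_i}{\tilde r_i}\Big),\] where the product is taken in the order $i=1,2,\dots,\tilde m$ from left to right (and equals $1$ if $\tilde m=0$).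
   Context: Permutations are multiplied by composition, $(\sigma\tau)(x)=\sigma(\tau(x))$; $(a,b)$ denotes a transposition. A Young tableau of shape $\lambda$ is a bijection from $D_\lambda=\{(i,j):1\leq j\leq\lambda_i\}$ to its set of entries, drawn as left-justified rows; $R_i(T)$, $C_j(T)$ are the sets of entries in row $i$, column $j$. The Young subtableau of shape $\mu\subset\lambda$ is the restriction to $D_\mu$. For a set $X$, $\mathfrak{a}(X)=\sum_{\sigma\in\mathfrak{S}_X}\sigma$, $\mathfrak{b}(X)=\sum_{\tau\in\mathfrak{S}_X}\mathrm{sgn}(\tau)\tau$; $\mathfrak{c}_\lambda(T)=\prod_i\mathfrak{a}(R_i(T))\cdot\prod_j\mathfrak{b}(C_j(T))$. The hook of $\mu$ at $(x,y)$ is $\{(x,j)\in D_\mu:j\geq y\}\cup\{(i,y)\in D_\mu:i\geq x\}$ and $\alpha_\mu$ is the product of the sizes of all hooks of $\mu$. *)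

theory Defs
  imports
    "HOL-Combinatorics.Combinatorics"
    "HOL-Library.Poly_Mapping"
    "HOL-Library.FuncSet"
begin

text \<open>
  Multiplication of \<open>poly_mapping\<close>s is convolution along an additively written
  monoid. To use it as the product of a group algebra, the type of finitary permutations is also
  equipped with additive notation for its (non-commutative) group structure: \<open>\<sigma> + \<tau>\<close> is the
  composition \<open>\<sigma> * \<tau>\<close>, that is \<open>x \<mapsto> \<sigma> (\<tau> x)\<close>.
\<close>

instantiation perm :: (type) group_add
begin

definition zero_perm :: "'a perm" where "0 = (1 :: 'a perm)"
definition plus_perm :: "'a perm \<Rightarrow> 'a perm \<Rightarrow> 'a perm" where "(\<sigma> :: 'a perm) + \<tau> = \<sigma> * \<tau>"
definition uminus_perm :: "'a perm \<Rightarrow> 'a perm" where "- (\<sigma> :: 'a perm) = inverse \<sigma>"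
definition minus_perm :: "'a perm \<Rightarrow> 'a perm \<Rightarrow> 'a perm" where "(\<sigma> :: 'a perm) - \<tau> = \<sigma> * inverse \<tau>"

instance
  by standard
    (simp_all add: zero_perm_def plus_perm_def uminus_perm_def minus_perm_def mult.assoc)

end

text \<open>
  The group algebra of the finitary permutations of the natural numbers. For every \<open>n\<close> it contains
  the group algebra of the symmetric group on \<open>{1..n}\<close>, as the subalgebra of the elements supported
  on permutations fixing every point outside \<open>{1..n}\<close>.
\<close>

type_synonym 'k group_alg = "nat perm \<Rightarrow>\<^sub>0 'k"

definition ga_of :: "nat perm \<Rightarrow> 'k::field_char_0 group_alg" where
  "ga_of \<sigma> = Poly_Mapping.single \<sigma> 1"

lemma ga_of_mult: "ga_of \<sigma> * ga_of \<tau> = ga_of (\<sigma> * \<tau>)"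
  by (simp add: ga_of_def mult_single plus_perm_def)

lemma ga_of_one: "ga_of 1 = 1"
  by (simp add: ga_of_def zero_perm_def [symmetric])

definition ga_scale :: "'k::field_char_0 \<Rightarrow> 'k group_alg \<Rightarrow> 'k group_alg" where
  "ga_scale c f = Poly_Mapping.map ((*) c) f"

definition sym_on :: "nat set \<Rightarrow> nat perm set" where
  "sym_on X = {\<sigma>. affected \<sigma> \<subseteq> X}"

lemma finite_sym_on:
  assumes "finite X"
  shows "finite (sym_on X)"
proof (rule finite_imageD)
  show "finite (Perm.apply ` sym_on X)"
    by (rule finite_subset [OF _ finite_permutations [OF assms]])
      (auto simp: sym_on_def permutes_def affected.rep_eq bij_iff [symmetric])
  show "inj_on Perm.apply (sym_on X)"
    by (simp add: inj_on_def apply_inject)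
qed

definition symmetrizer :: "nat set \<Rightarrow> 'k::field_char_0 group_alg" where
  "symmetrizer X = (\<Sum>\<sigma>\<in>sym_on X. ga_of \<sigma>)"

definition antisymmetrizer :: "nat set \<Rightarrow> 'k::field_char_0 group_alg" where
  "antisymmetrizer X = (\<Sum>\<tau>\<in>sym_on X. ga_scale (of_int (sign (Perm.apply \<tau>))) (ga_of \<tau>))"

text \<open>
  Partitions are functions whose parts are indexed from 1; the value at the unused index 0 is
  fixed to be 0.
\<close>

definition is_partition :: "(nat \<Rightarrow> nat) \<Rightarrow> nat \<Rightarrow> bool" where
  "is_partition lam n \<longleftrightarrow>
     lam 0 = 0 \<and> (\<forall>i\<ge>1. lam (Suc i) \<le> lam i) \<and> finite {i. lam i \<noteq> 0} \<and>
     (\<Sum>i\<in>{i. lam i \<noteq> 0}. lam i) = n"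

definition diagram :: "(nat \<Rightarrow> nat) \<Rightarrow> (nat \<times> nat) set" where
  "diagram lam = {(i, j). 1 \<le> i \<and> 1 \<le> j \<and> j \<le> lam i}"

definition col_len :: "(nat \<Rightarrow> nat) \<Rightarrow> nat \<Rightarrow> nat" where
  "col_len lam j = card {i. (i, j) \<in> diagram lam}"

type_synonym tableau = "nat \<times> nat \<Rightarrow> nat"

definition is_tableau :: "(nat \<Rightarrow> nat) \<Rightarrow> nat set \<Rightarrow> tableau \<Rightarrow> bool" where
  "is_tableau lam E T \<longleftrightarrow> bij_betw T (diagram lam) E"

definition subtableau :: "(nat \<Rightarrow> nat) \<Rightarrow> tableau \<Rightarrow> tableau" where
  "subtableau mu T = restrict T (diagram mu)"

definition row_entries :: "(nat \<Rightarrow> nat) \<Rightarrow> tableau \<Rightarrow> nat \<Rightarrow> nat set" where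
  "row_entries lam T i = {T (i, j) | j. (i, j) \<in> diagram lam}"

definition col_entries :: "(nat \<Rightarrow> nat) \<Rightarrow> tableau \<Rightarrow> nat \<Rightarrow> nat set" where
  "col_entries lam T j = {T (i, j) | i. (i, j) \<in> diagram lam}"

text \<open>The first column has as many boxes as there are rows, the first row as many as columns.\<close>

definition young_symmetrizer :: "(nat \<Rightarrow> nat) \<Rightarrow> tableau \<Rightarrow> 'k::field_char_0 group_alg" where
  "young_symmetrizer lam T =
     (\<Prod>i\<leftarrow>[1..<Suc (col_len lam 1)]. symmetrizer (row_entries lam T i)) *
     (\<Prod>j\<leftarrow>[1..<Suc (lam 1)]. antisymmetrizer (col_entries lam T j))"

definition hook :: "(nat \<Rightarrow> nat) \<Rightarrow> nat \<Rightarrow> nat \<Rightarrow> (nat \<times> nat) set" where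
  "hook mu x y =
     {(x, j) | j. (x, j) \<in> diagram mu \<and> y \<le> j} \<union> {(i, y) | i. (i, y) \<in> diagram mu \<and> x \<le> i}"

definition hook_product :: "(nat \<Rightarrow> nat) \<Rightarrow> nat" where
  "hook_product mu = (\<Prod>(x, y)\<in>diagram mu. card (hook mu x y))"

text \<open>Removal of the first \<open>v\<close> columns; note that subtraction is truncated.\<close>

definition drop_cols_shape :: "nat \<Rightarrow> (nat \<Rightarrow> nat) \<Rightarrow> nat \<Rightarrow> nat" where
  "drop_cols_shape v mu i = mu i - v"

definition drop_cols :: "nat \<Rightarrow> (nat \<Rightarrow> nat) \<Rightarrow> tableau \<Rightarrow> tableau" where
  "drop_cols v mu S = restrict (\<lambda>(i, j). S (i, j + v)) (diagram (drop_cols_shape v mu))"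

text \<open>A block is represented by the set of the indices of its columns.\<close>

definition equal_run :: "(nat \<Rightarrow> nat) \<Rightarrow> nat set \<Rightarrow> bool" where
  "equal_run mu B \<longleftrightarrow>
     (\<exists>p q. 1 \<le> p \<and> p \<le> q \<and> q \<le> mu 1 \<and> B = {p..q}) \<and>
     (\<forall>c\<in>B. \<forall>d\<in>B. col_len mu c = col_len mu d)"

definition is_block :: "(nat \<Rightarrow> nat) \<Rightarrow> nat set \<Rightarrow> bool" where
  "is_block mu B \<longleftrightarrow> equal_run mu B \<and> (\<forall>B'. equal_run mu B' \<and> B \<subseteq> B' \<longrightarrow> B' = B)"

definition blocks_left_to_right :: "(nat \<Rightarrow> nat) \<Rightarrow> nat \<Rightarrow> (nat \<Rightarrow> nat set) \<Rightarrow> bool" where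
  "blocks_left_to_right mu m B \<longleftrightarrow>
     B ` {1..m} = {C. is_block mu C} \<and>
     (\<forall>i\<in>{1..m}. \<forall>j\<in>{1..m}. i < j \<longrightarrow> (\<forall>c\<in>B i. \<forall>d\<in>B j. c < d))"

definition block_entries :: "(nat \<Rightarrow> nat) \<Rightarrow> tableau \<Rightarrow> nat set \<Rightarrow> nat set" where
  "block_entries mu S B = (\<Union>j\<in>B. col_entries mu S j)"

end

theory Submission
  imports Defs
begin

text \<open>
  Call \<open>w\<close> a Specht vector for a tableau if it alternates under the columns and satisfies the
  one-box exchange relations \<open>w (\<Sum>x\<in>C\<^sub>j. (x, y)) = w\<close> for \<open>y\<close> in column \<open>j + 1\<close>; a Young
  symmetrizer is one for its own tableau. If \<open>w\<close> is a Specht vector for \<open>T\<close> and \<open>P\<close> is the product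
  of the factors \<open>1 - (\<Sum>b\<in>C\<^sub>c. (a, b)) / \<rho>\<^sub>c\<close> over the single columns \<open>c\<close> to the right of the
  corner \<open>a\<close>, then \<open>w P\<close> is a Specht vector for \<open>S\<close>, while \<open>w P c\<^sub>\<mu>(S) = w c\<^sub>\<mu>(S)\<close> because every
  term containing a transposition \<open>(a, b)\<close> dies on the row of \<open>b\<close>. So everything reduces to
  \<open>w' c\<^sub>\<mu>(S) = \<alpha>\<^sub>\<mu> w'\<close> for Specht vectors \<open>w'\<close> of \<open>S\<close>. This follows by induction on the size by the
  same argument, applied to a corner in the last row: \<open>c\<^sub>\<lambda> = (1 + X) c\<^sub>\<mu> (1 - Y)\<close>, the factor \<open>1 + X\<close>
  contributes the new row hooks, and \<open>w P (1 - Y)\<close> is a multiple of \<open>w\<close> by the quotient of the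
  column hooks. Finally the column factors of a block collapse to one factor, since columns of equal
  length may be exchanged.
\<close>

section \<open>Transpositions and scalars in the group algebra\<close>

text \<open>General Specht vectors are used because \<open>w P\<close> need not be a Young
  symmetrizer: the induction needs a class of vectors that is closed under removing a corner.
  Passing to single columns localizes the argument, since the exchange relation of two neighbouring
  columns is affected only by the factors of these two. The constant \<rho>_c is then forced: it is
  the axial distance from the bottom box of column c to the corner. Next to the corner this value
  cancels the defect caused by the loss of \<open>a\<close>, and further right its increments make
  the defects of neighbouring factors cancel. At the last column of a block it is the hook length
  r_i, the only weight that survives the collapse of the block. The collapse also needs exchange
  relations from right to left between columns of equal length. Characteristic zero enters through
  the nonzero integers \<rho>_c, through the factorials that normalize antisymmetrizers, and through
  the deduction of f = 0 from f = -f.\<close>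

definition tr :: "nat \<Rightarrow> nat \<Rightarrow> 'k::field_char_0 group_alg" where
  "tr x y = ga_of (Perm.swap x y)"

text \<open>The key \<open>0\<close> is the identity permutation in additive notation. Scalars thus
  become central ring elements, and identities with coefficients are left to ring
  simplification.\<close>

definition scal :: "'k::field_char_0 \<Rightarrow> 'k group_alg" where
  "scal c = Poly_Mapping.single 0 c"

lemma scal_simps [simp]:
  "scal 0 = 0" "scal 1 = 1" "scal (of_nat n) = of_nat n" "scal (numeral m) = numeral m"
  by (simp_all add: scal_def)

lemma scal_add: "scal (c + d) = scal c + scal d"
  and scal_diff: "scal (c - d) = scal c - scal d"
  and scal_minus: "scal (- c) = - scal c"
  and scal_mult: "scal (c * d) = scal c * scal d"
  by (simp_all add: scal_def single_add single_diff single_uminus mult_single)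

lemma scal_mult_single: "scal c * Poly_Mapping.single \<sigma> d = Poly_Mapping.single \<sigma> (c * d)"
  by (simp add: scal_def mult_single)

lemma group_alg_induct [case_names single sum]:
  fixes f :: "'k::field_char_0 group_alg"
  assumes single: "\<And>\<sigma> c. P (Poly_Mapping.single \<sigma> c)"
    and sum: "\<And>f g. P f \<Longrightarrow> P g \<Longrightarrow> P (f + g)"
  shows "P f"
proof (induction f rule: update_induct)
  case const
  show ?case using single[of 0 0] by simp
next
  case (update f \<sigma> c)
  have "Poly_Mapping.update \<sigma> c f = f + Poly_Mapping.single \<sigma> c"
    using update(1) by (intro poly_mapping_eqI)
      (auto simp: lookup_update lookup_add lookup_single when_def in_keys_iff)
  then show ?case using update single sum by simp
qed

lemma ga_scale_eq: "ga_scale c f = scal c * f"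
proof (induction f rule: group_alg_induct)
  case (single k v)
  have "Poly_Mapping.map ((*) c) (Poly_Mapping.single k v) = Poly_Mapping.single k (c * v)"
    by (rule poly_mapping_eqI) (simp add: map.rep_eq lookup_single when_def)
  then show ?case
    by (simp add: ga_scale_def scal_mult_single)
next
  case (sum f g)
  have "ga_scale c (f + g) = ga_scale c f + ga_scale c g"
    unfolding ga_scale_def
    by (rule poly_mapping_eqI) (auto simp: map.rep_eq lookup_add when_def simp flip: distrib_left)
  with sum show ?case by (simp add: distrib_left)
qed

lemma scal_commute: "f * scal c = scal c * f"
proof (induction f rule: group_alg_induct)
  case (single k v)
  then show ?case by (simp add: scal_def mult_single mult.commute)
qed (simp add: algebra_simps)

lemma scal_left_commute: "f * (scal c * g) = scal c * (f * g)"
  by (metis mult.assoc scal_commute)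

lemma scal_cancel: "c \<noteq> 0 \<Longrightarrow> scal c * f = scal c * g \<longleftrightarrow> f = g"
proof
  assume "c \<noteq> 0" "scal c * f = scal c * g"
  then have "scal (inverse c * c) * f = scal (inverse c * c) * g"
    unfolding scal_mult mult.assoc by simp
  then show "f = g" using \<open>c \<noteq> 0\<close> by simp
qed simp

text \<open>Vanishing is proved by absorbing one transposition with opposite signs from two sides;
  the conclusion needs 2 to be invertible.\<close>

lemma eq_uminus_self_iff: "(f :: 'k::field_char_0 group_alg) = - f \<longleftrightarrow> f = 0"
proof
  assume f: "f = - f"
  have "f + f = f + - f" by (rule arg_cong[OF f])
  then have "scal 2 * f = scal 2 * 0"
    by (simp add: mult_2)
  then show "f = 0" using scal_cancel[of 2 f 0] by simp
qed simp

lemma ga_of_tr: "ga_of \<sigma> * tr x y = tr (Perm.apply \<sigma> x) (Perm.apply \<sigma> y) * ga_of \<sigma>"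
proof -
  have "\<sigma> * Perm.swap x y = Perm.swap (Perm.apply \<sigma> x) (Perm.apply \<sigma> y) * \<sigma>"
    by (rule perm_eqI) (auto simp: apply_times swap.rep_eq transpose_def apply_inj)
  then show ?thesis by (simp add: tr_def ga_of_mult)
qed

lemma tr_sym: "tr x y = tr y x"
  by (simp add: tr_def swap_sym)

lemma tr_self [simp]: "tr x x = 1"
  by (simp add: tr_def ga_of_one)

lemma tr_square: "tr x y * tr x y = 1"
proof -
  have "Perm.swap x y * Perm.swap x y = 1"
    by (rule perm_eqI) (auto simp: apply_times swap.rep_eq transpose_def)
  then show ?thesis by (simp add: tr_def ga_of_mult ga_of_one)
qed

lemma tr_conj: "tr p q * tr x y = tr (transpose p q x) (transpose p q y) * tr p q"
  using ga_of_tr[of "Perm.swap p q" x y] by (simp add: tr_def swap.rep_eq)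

lemma tr_commute: "{p, q} \<inter> {x, y} = {} \<Longrightarrow> tr p q * tr x y = tr x y * tr p q"
  by (subst tr_conj) (auto simp: transpose_def)

text \<open>For x \<noteq> y both sides are the 3-cycle sending x to y, y to z and z to x. The
  rewriting serves to bring to the front a transposition that the vector on the left absorbs up to
  sign.\<close>

lemma tr_cycle: "z \<noteq> x \<Longrightarrow> z \<noteq> y \<Longrightarrow> tr x y * tr y z = tr x z * tr x y"
  by (subst tr_conj) (auto simp: transpose_def)

text \<open>A sum of Jucys-Murphy type. Conjugation by a transposition only relabels
  \<open>C\<close> and \<open>y\<close>, which drives all later computations.\<close>

definition trsum :: "nat set \<Rightarrow> nat \<Rightarrow> 'k::field_char_0 group_alg" where
  "trsum C y = (\<Sum>x\<in>C. tr x y)"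

lemma trsum_insert: "finite C \<Longrightarrow> x \<notin> C \<Longrightarrow> trsum (insert x C) y = tr x y + trsum C y"
  by (simp add: trsum_def)

section \<open>Commutation of transpositions with sums and products\<close>

definition commutes :: "'a::times \<Rightarrow> 'a \<Rightarrow> bool" where
  "commutes f g \<longleftrightarrow> f * g = g * f"

lemma commutes_sym: "commutes f g \<Longrightarrow> commutes g f"
  by (simp add: commutes_def)

lemma commutes_one [simp]: "commutes f (1 :: 'a::monoid_mult)"
  by (simp add: commutes_def)

lemma commutes_scal [simp]: "commutes f (scal c)"
  by (simp add: commutes_def scal_commute)

lemma mult_eq_left: "a * b = c * d \<Longrightarrow> w * a * b = w * c * (d :: 'a::semigroup_mult)"
  by (simp add: mult.assoc)

lemma commutes_right: "commutes f g \<Longrightarrow> w * f * g = w * g * (f :: 'a::semigroup_mult)"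
  by (simp add: commutes_def mult.assoc)

lemma commutes_mult:
  assumes "commutes f g" "commutes f h"
  shows "commutes (f :: 'a::semigroup_mult) (g * h)"
  using assms commutes_right[OF assms(2), of g] by (simp add: commutes_def flip: mult.assoc)

lemma commutes_add: "commutes f g \<Longrightarrow> commutes f h \<Longrightarrow> commutes (f :: 'a::ring) (g + h)"
  by (simp add: commutes_def algebra_simps)

lemma commutes_diff: "commutes f g \<Longrightarrow> commutes f h \<Longrightarrow> commutes (f :: 'a::ring) (g - h)"
  by (simp add: commutes_def algebra_simps)

lemma commutes_sum: "(\<And>x. x \<in> C \<Longrightarrow> commutes f (g x)) \<Longrightarrow> commutes (f :: 'a::ring) (sum g C)"
  by (simp add: commutes_def sum_distrib_left sum_distrib_right)

lemma commutes_prod_list: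
  "(\<And>g. g \<in> set gs \<Longrightarrow> commutes f g) \<Longrightarrow> commutes (f :: 'a::monoid_mult) (prod_list gs)"
  by (induction gs) (auto intro: commutes_mult)

lemma commutes_tr: "{p, q} \<inter> {x, y} = {} \<Longrightarrow> commutes (tr p q) (tr x y)"
  by (simp add: commutes_def tr_commute)

lemma commutes_tr_trsum_outside:
  "p \<notin> C \<Longrightarrow> q \<notin> C \<Longrightarrow> p \<noteq> y \<Longrightarrow> q \<noteq> y \<Longrightarrow> commutes (tr p q) (trsum C y)"
  unfolding trsum_def by (intro commutes_sum commutes_tr) auto

lemma tr_mult_trsum:
  "tr p q * trsum C y = trsum (transpose p q ` C) (transpose p q y) * tr p q"
proof -
  have "tr p q * trsum C y = (\<Sum>x\<in>C. tr (transpose p q x) (transpose p q y)) * tr p q"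
    unfolding trsum_def sum_distrib_left sum_distrib_right
    by (rule sum.cong[OF refl], rule tr_conj)
  also have "(\<Sum>x\<in>C. tr (transpose p q x) (transpose p q y)) =
      trsum (transpose p q ` C) (transpose p q y)"
    unfolding trsum_def by (subst sum.reindex) auto
  finally show ?thesis .
qed

lemma commutes_tr_trsum_inside:
  "p \<in> C \<Longrightarrow> q \<in> C \<Longrightarrow> y \<notin> C \<Longrightarrow> commutes (tr p q) (trsum C y)"
  unfolding commutes_def tr_mult_trsum
  by (rule arg_cong2[where f="(*)"], rule arg_cong2[where f=trsum]) (auto simp: transpose_def)

section \<open>Symmetrizers\<close>

lemma in_sym_on_apply: "\<sigma> \<in> sym_on X \<Longrightarrow> x \<notin> X \<Longrightarrow> Perm.apply \<sigma> x = x"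
  by (auto simp: sym_on_def in_affected)

lemma sym_onI: "(\<And>x. x \<notin> X \<Longrightarrow> Perm.apply \<sigma> x = x) \<Longrightarrow> \<sigma> \<in> sym_on X"
  unfolding sym_on_def mem_Collect_eq subset_iff in_affected by metis

lemma sym_on_apply_in: "\<sigma> \<in> sym_on X \<Longrightarrow> x \<in> X \<Longrightarrow> Perm.apply \<sigma> x \<in> X"
  by (metis apply_inj in_sym_on_apply)

lemma sym_on_mult: "\<sigma> \<in> sym_on X \<Longrightarrow> \<tau> \<in> sym_on X \<Longrightarrow> \<sigma> * \<tau> \<in> sym_on X"
  by (rule sym_onI) (simp add: apply_times in_sym_on_apply)

lemma sym_on_inverse: "\<sigma> \<in> sym_on X \<Longrightarrow> inverse \<sigma> \<in> sym_on X"
  by (simp add: sym_on_def)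

lemma sym_on_swap: "x \<in> X \<Longrightarrow> y \<in> X \<Longrightarrow> Perm.swap x y \<in> sym_on X"
  by (rule sym_onI) (auto simp: swap.rep_eq transpose_def)

lemma swap_swap_mult: "Perm.swap x y * (Perm.swap x y * \<sigma>) = \<sigma>"
  by (rule perm_eqI) (auto simp: apply_times swap.rep_eq transpose_def)

lemma mult_swap_swap: "\<sigma> * Perm.swap x y * Perm.swap x y = \<sigma>"
  by (rule perm_eqI) (auto simp: apply_times swap.rep_eq transpose_def)

lemma sym_on_empty: "sym_on {} = {1}"
  by (auto simp: sym_on_def)

lemma sum_sym_on_swap_mult:
  "x \<in> X \<Longrightarrow> y \<in> X \<Longrightarrow> (\<Sum>\<sigma>\<in>sym_on X. f (Perm.swap x y * \<sigma>)) = (\<Sum>\<sigma>\<in>sym_on X. f \<sigma>)"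
  by (rule sum.reindex_bij_witness[of _ "\<lambda>\<sigma>. Perm.swap x y * \<sigma>" "\<lambda>\<sigma>. Perm.swap x y * \<sigma>"])
    (auto simp: swap_swap_mult intro: sym_on_mult sym_on_swap)

lemma sum_sym_on_mult_swap:
  "x \<in> X \<Longrightarrow> y \<in> X \<Longrightarrow> (\<Sum>\<sigma>\<in>sym_on X. f (\<sigma> * Perm.swap x y)) = (\<Sum>\<sigma>\<in>sym_on X. f \<sigma>)"
  by (rule sum.reindex_bij_witness[of _ "\<lambda>\<sigma>. \<sigma> * Perm.swap x y" "\<lambda>\<sigma>. \<sigma> * Perm.swap x y"])
    (auto simp: mult_swap_swap intro: sym_on_mult sym_on_swap)

text \<open>Coset decomposition over the stabilizer of \<open>a\<close>: the coset of \<sigma> is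
  determined by b = \<sigma>(a), and (b a) \<sigma> fixes \<open>a\<close>. The value b = a gives
  the trivial coset.\<close>

lemma sum_sym_on_insert_left:
  assumes "a \<notin> X"
  shows "(\<Sum>\<sigma>\<in>sym_on (insert a X). f \<sigma>) = (\<Sum>b\<in>insert a X. \<Sum>\<tau>\<in>sym_on X. f (Perm.swap b a * \<tau>))"
  unfolding sum.cartesian_product
proof (rule sum.reindex_bij_witness[of _ "\<lambda>(b, \<tau>). Perm.swap b a * \<tau>"
      "\<lambda>\<sigma>. (Perm.apply \<sigma> a, Perm.swap (Perm.apply \<sigma> a) a * \<sigma>)"])
  fix \<sigma> assume s: "\<sigma> \<in> sym_on (insert a X)"
  have "Perm.swap (Perm.apply \<sigma> a) a * \<sigma> \<in> sym_on X"
  proof (rule sym_onI)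
    fix x assume "x \<notin> X"
    then show "Perm.apply (Perm.swap (Perm.apply \<sigma> a) a * \<sigma>) x = x"
      using in_sym_on_apply[OF s, of x] sym_on_apply_in[OF s, of a] apply_inj[of \<sigma> x a]
      by (cases "x = a") (auto simp: apply_times swap.rep_eq transpose_def)
  qed
  then show "(Perm.apply \<sigma> a, Perm.swap (Perm.apply \<sigma> a) a * \<sigma>) \<in> insert a X \<times> sym_on X"
    using sym_on_apply_in[OF s, of a] by auto
next
  fix p assume "p \<in> insert a X \<times> sym_on X"
  then obtain b \<tau> where p: "p = (b, \<tau>)" "b \<in> insert a X" "\<tau> \<in> sym_on X" by auto
  have "\<tau> \<in> sym_on (insert a X)" using p by (auto simp: sym_on_def)
  then show "(case p of (b, \<tau>) \<Rightarrow> Perm.swap b a * \<tau>) \<in> sym_on (insert a X)"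
    using p by (auto intro: sym_on_mult sym_on_swap)
  have "Perm.apply (Perm.swap b a * \<tau>) a = b"
    using in_sym_on_apply[OF p(3) assms] by (simp add: apply_times swap.rep_eq transpose_def)
  then show "(Perm.apply (case p of (b, \<tau>) \<Rightarrow> Perm.swap b a * \<tau>) a,
        Perm.swap (Perm.apply (case p of (b, \<tau>) \<Rightarrow> Perm.swap b a * \<tau>) a) a *
        (case p of (b, \<tau>) \<Rightarrow> Perm.swap b a * \<tau>)) = p"
    by (simp add: p(1) swap_swap_mult)
qed (auto simp: swap_swap_mult)

lemma sum_sym_on_inverse: "(\<Sum>\<sigma>\<in>sym_on X. f (inverse \<sigma>)) = (\<Sum>\<sigma>\<in>sym_on X. f \<sigma>)"
  by (rule sum.reindex_bij_witness[of _ inverse inverse]) (auto intro: sym_on_inverse)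

lemma sum_sym_on_insert_right:
  assumes "a \<notin> X"
  shows "(\<Sum>\<sigma>\<in>sym_on (insert a X). f \<sigma>) = (\<Sum>b\<in>insert a X. \<Sum>\<tau>\<in>sym_on X. f (\<tau> * Perm.swap b a))"
proof -
  have "(\<Sum>\<sigma>\<in>sym_on (insert a X). f \<sigma>) = (\<Sum>\<sigma>\<in>sym_on (insert a X). f (inverse \<sigma>))"
    by (rule sum_sym_on_inverse[symmetric])
  also have "\<dots> = (\<Sum>b\<in>insert a X. \<Sum>\<tau>\<in>sym_on X. f (inverse \<tau> * Perm.swap b a))"
    by (simp add: sum_sym_on_insert_left[OF assms])
  also have "\<dots> = (\<Sum>b\<in>insert a X. \<Sum>\<tau>\<in>sym_on X. f (\<tau> * Perm.swap b a))"
    by (rule sum.cong[OF refl]) (rule sum_sym_on_inverse)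
  finally show ?thesis .
qed

definition perm_sign :: "nat perm \<Rightarrow> 'k::field_char_0 group_alg" where
  "perm_sign \<sigma> = scal (of_int (sign (Perm.apply \<sigma>)))"

lemma permutation_apply: "permutation (Perm.apply \<sigma>)"
  using bij_apply finite_affected[of \<sigma>] by (simp add: permutation affected.rep_eq)

lemma perm_sign_mult: "perm_sign (\<sigma> * \<tau>) = perm_sign \<sigma> * perm_sign \<tau>"
  by (simp add: perm_sign_def apply_times sign_compose permutation_apply flip: scal_mult)

lemma perm_sign_swap: "x \<noteq> y \<Longrightarrow> perm_sign (Perm.swap x y) = -1"
  by (simp add: perm_sign_def swap.rep_eq sign_swap_id scal_minus)

lemma perm_sign_commute: "f * perm_sign \<sigma> = perm_sign \<sigma> * f"
  by (simp add: perm_sign_def scal_commute)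

lemma perm_sign_conj: "perm_sign (\<sigma> * \<tau> * inverse \<sigma>) = perm_sign \<tau>"
proof -
  have "perm_sign (\<sigma> * \<tau> * inverse \<sigma>) = perm_sign \<tau> * perm_sign (\<sigma> * inverse \<sigma>)"
    by (simp only: perm_sign_mult perm_sign_commute[of "perm_sign \<sigma>" \<tau>] mult.assoc[symmetric])
  then show ?thesis by (simp add: perm_sign_def)
qed

lemma antisymmetrizer_eq: "antisymmetrizer X = (\<Sum>\<tau>\<in>sym_on X. perm_sign \<tau> * ga_of \<tau>)"
  by (simp add: antisymmetrizer_def ga_scale_eq perm_sign_def)

lemma symmetrizer_empty [simp]: "symmetrizer {} = 1"
  by (simp add: symmetrizer_def sym_on_empty ga_of_one)

lemma antisymmetrizer_empty [simp]: "antisymmetrizer {} = 1"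
  by (simp add: antisymmetrizer_eq sym_on_empty ga_of_one perm_sign_def)

text \<open>The new factor is split off on the left here and on the right for antisymmetrizers, so
  that in rows times columns both new factors end up on the outside.\<close>

lemma symmetrizer_insert:
  assumes "finite X" "a \<notin> X"
  shows "symmetrizer (insert a X) = (1 + trsum X a) * symmetrizer X"
proof -
  have "symmetrizer (insert a X) = (\<Sum>b\<in>insert a X. tr b a * symmetrizer X)"
    unfolding symmetrizer_def sum_sym_on_insert_left[OF assms(2)]
    by (simp add: sum_distrib_left tr_def ga_of_mult)
  also have "\<dots> = (1 + trsum X a) * symmetrizer X"
    using assms by (simp add: trsum_def distrib_right sum_distrib_right)
  finally show ?thesis .
qed

lemma antisymmetrizer_insert:
  assumes "finite X" "a \<notin> X"
  shows "(antisymmetrizer (insert a X) :: 'k::field_char_0 group_alg) = antisymmetrizer X * (1 - trsum X a)"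
proof -
  have "(antisymmetrizer (insert a X) :: 'k group_alg) = (\<Sum>b\<in>insert a X. antisymmetrizer X * (perm_sign (Perm.swap b a) * tr b a))"
    unfolding antisymmetrizer_eq sum_sym_on_insert_right[OF assms(2)]
  proof (rule sum.cong[OF refl])
    fix b
    have "(perm_sign (\<tau> * Perm.swap b a) * ga_of (\<tau> * Perm.swap b a) :: 'k group_alg) =
        perm_sign \<tau> * ga_of \<tau> * (perm_sign (Perm.swap b a) * tr b a)" for \<tau>
    proof -
      have "(ga_of \<tau> * perm_sign (Perm.swap b a) :: 'k group_alg) = perm_sign (Perm.swap b a) * ga_of \<tau>"
        by (rule perm_sign_commute)
      then show ?thesis
        by (simp add: perm_sign_mult tr_def mult.assoc flip: ga_of_mult) (simp flip: mult.assoc)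
    qed
    then show "(\<Sum>\<tau>\<in>sym_on X. perm_sign (\<tau> * Perm.swap b a) * ga_of (\<tau> * Perm.swap b a) :: 'k group_alg) =
        (\<Sum>\<tau>\<in>sym_on X. perm_sign \<tau> * ga_of \<tau>) * (perm_sign (Perm.swap b a) * tr b a)"
      by (simp add: sum_distrib_right)
  qed
  also have "\<dots> = antisymmetrizer X * (1 + (\<Sum>b\<in>X. perm_sign (Perm.swap b a) * tr b a))"
    using assms by (simp add: distrib_left sum_distrib_left perm_sign_def)
  also have "(\<Sum>b\<in>X. perm_sign (Perm.swap b a) * tr b a :: 'k group_alg) = - trsum X a"
    unfolding trsum_def sum_negf[symmetric] using assms
    by (intro sum.cong refl, subst perm_sign_swap) auto
  finally show ?thesis by simp
qed

lemma tr_mult_symmetrizer: "x \<in> X \<Longrightarrow> y \<in> X \<Longrightarrow> tr x y * symmetrizer X = symmetrizer X"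
  unfolding symmetrizer_def
  by (subst (2) sum_sym_on_swap_mult[of x X y, symmetric])
    (simp_all add: sum_distrib_left tr_def ga_of_mult)

lemma symmetrizer_mult_tr: "x \<in> X \<Longrightarrow> y \<in> X \<Longrightarrow> symmetrizer X * tr x y = symmetrizer X"
  unfolding symmetrizer_def
  by (subst (2) sum_sym_on_mult_swap[of x X y, symmetric])
    (simp_all add: sum_distrib_right tr_def ga_of_mult)

lemma antisymmetrizer_mult_tr:
  assumes xy: "x \<in> X" "y \<in> X" "x \<noteq> y"
  shows "antisymmetrizer X * tr x y = - (antisymmetrizer X :: 'k::field_char_0 group_alg)"
proof -
  have "(perm_sign \<tau> * ga_of \<tau> * tr x y :: 'k group_alg) =
      - (perm_sign (\<tau> * Perm.swap x y) * ga_of (\<tau> * Perm.swap x y))" for \<tau>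
    using xy by (simp add: perm_sign_mult perm_sign_swap tr_def ga_of_mult mult.assoc)
  then show ?thesis
    unfolding antisymmetrizer_eq sum_distrib_right
    using sum_sym_on_mult_swap[OF xy(1,2), of "\<lambda>\<tau>. perm_sign \<tau> * ga_of \<tau> :: 'k group_alg"]
    by (simp add: sum_negf)
qed

lemma tr_mult_antisymmetrizer:
  assumes xy: "x \<in> X" "y \<in> X" "x \<noteq> y"
  shows "tr x y * antisymmetrizer X = - (antisymmetrizer X :: 'k::field_char_0 group_alg)"
proof -
  have "(tr x y :: 'k group_alg) * (perm_sign \<tau> * ga_of \<tau>) =
      - (perm_sign (Perm.swap x y * \<tau>) * ga_of (Perm.swap x y * \<tau>))" for \<tau>
  proof -
    have "tr x y * (perm_sign \<tau> * ga_of \<tau>) = perm_sign \<tau> * (tr x y * ga_of \<tau>)"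
      unfolding mult.assoc[symmetric] perm_sign_commute ..
    then show ?thesis using xy by (simp add: perm_sign_mult perm_sign_swap tr_def ga_of_mult)
  qed
  then show ?thesis
    unfolding antisymmetrizer_eq sum_distrib_left
    using sum_sym_on_swap_mult[OF xy(1,2), of "\<lambda>\<tau>. perm_sign \<tau> * ga_of \<tau> :: 'k group_alg"]
    by (simp add: sum_negf)
qed

text \<open>Conjugation by \<sigma> maps the symmetric group on \<open>X\<close> to the one on the
  image of \<open>X\<close>, and the sign is invariant under conjugation.\<close>

lemma ga_of_mult_antisymmetrizer:
  "(ga_of \<sigma> * antisymmetrizer X :: 'k::field_char_0 group_alg) = antisymmetrizer (Perm.apply \<sigma> ` X) * ga_of \<sigma>"
proof -
  have *: "(ga_of \<sigma> * (perm_sign \<tau> * ga_of \<tau>) :: 'k group_alg) =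
      perm_sign (\<sigma> * \<tau> * inverse \<sigma>) * ga_of (\<sigma> * \<tau> * inverse \<sigma>) * ga_of \<sigma>" for \<tau>
  proof -
    have "(ga_of \<sigma> * (perm_sign \<tau> * ga_of \<tau>) :: 'k group_alg) = perm_sign \<tau> * (ga_of \<sigma> * ga_of \<tau>)"
      unfolding mult.assoc[symmetric] perm_sign_commute ..
    then show ?thesis
      unfolding perm_sign_conj by (simp add: ga_of_mult mult.assoc)
  qed
  have i: "Perm.apply (inverse \<sigma>) (Perm.apply \<sigma> x) = x"
    "Perm.apply \<sigma> (Perm.apply (inverse \<sigma>) x) = x" for x
    by (simp_all add: apply_sequence)
  have j: "inverse \<sigma> * (\<sigma> * \<tau>) = \<tau>" "\<sigma> * (inverse \<sigma> * \<tau>) = \<tau>" for \<tau>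
    by (simp_all flip: mult.assoc)
  have "(\<Sum>\<tau>\<in>sym_on X. perm_sign (\<sigma> * \<tau> * inverse \<sigma>) * ga_of (\<sigma> * \<tau> * inverse \<sigma>) :: 'k group_alg) =
    antisymmetrizer (Perm.apply \<sigma> ` X)"
    unfolding antisymmetrizer_eq
  proof (rule sum.reindex_bij_witness[of _ "\<lambda>\<tau>. inverse \<sigma> * \<tau> * \<sigma>" "\<lambda>\<tau>. \<sigma> * \<tau> * inverse \<sigma>"])
    fix \<tau> assume t: "\<tau> \<in> sym_on X"
    show "\<sigma> * \<tau> * inverse \<sigma> \<in> sym_on (Perm.apply \<sigma> ` X)"
    proof (rule sym_onI)
      fix x assume "x \<notin> Perm.apply \<sigma> ` X"
      then have "Perm.apply (inverse \<sigma>) x \<notin> X" by (metis i(2) image_eqI)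
      then show "Perm.apply (\<sigma> * \<tau> * inverse \<sigma>) x = x"
        using t by (simp add: apply_times in_sym_on_apply i)
    qed
  next
    fix \<tau> assume t: "\<tau> \<in> sym_on (Perm.apply \<sigma> ` X)"
    show "inverse \<sigma> * \<tau> * \<sigma> \<in> sym_on X"
    proof (rule sym_onI)
      fix x assume "x \<notin> X"
      then have "Perm.apply \<sigma> x \<notin> Perm.apply \<sigma> ` X" by (auto simp: apply_inj)
      then show "Perm.apply (inverse \<sigma> * \<tau> * \<sigma>) x = x"
        using t by (simp add: apply_times in_sym_on_apply i)
    qed
  qed (auto simp: mult.assoc j)
  then show ?thesis
    unfolding antisymmetrizer_eq[of X] sum_distrib_left * sum_distrib_right[symmetric] by simp
qed

lemma commutes_tr_ga_of:
  "\<sigma> \<in> sym_on X \<Longrightarrow> x \<notin> X \<Longrightarrow> y \<notin> X \<Longrightarrow> commutes (tr x y) (ga_of \<sigma>)"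
  by (simp add: commutes_def ga_of_tr in_sym_on_apply)

lemma commutes_tr_symmetrizer: "x \<notin> X \<Longrightarrow> y \<notin> X \<Longrightarrow> commutes (tr x y) (symmetrizer X)"
  unfolding symmetrizer_def by (intro commutes_sum commutes_tr_ga_of)

lemma commutes_tr_antisymmetrizer: "x \<notin> X \<Longrightarrow> y \<notin> X \<Longrightarrow> commutes (tr x y) (antisymmetrizer X)"
  unfolding antisymmetrizer_eq perm_sign_def
  by (intro commutes_sum commutes_mult commutes_tr_ga_of commutes_scal)

section \<open>Alternating columns and Garnir relations\<close>

definition alternates :: "'k::field_char_0 group_alg \<Rightarrow> nat set \<Rightarrow> bool" where
  "alternates w C \<longleftrightarrow> (\<forall>x\<in>C. \<forall>y\<in>C. x \<noteq> y \<longrightarrow> w * tr x y = - w)"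

text \<open>If \<open>w\<close> alternates under a finite \<open>C\<close> and y is not in
  \<open>C\<close>, then \<open>w * antisymmetrizer (insert y C)\<close> is (card C)! times
  \<open>w * (1 - trsum C y)\<close>. The relation thus says that this antisymmetrizer kills
  \<open>w\<close>: the Garnir relation for moving a single box.\<close>

definition garnir :: "'k::field_char_0 group_alg \<Rightarrow> nat set \<Rightarrow> nat set \<Rightarrow> bool" where
  "garnir w C C' \<longleftrightarrow> (\<forall>y\<in>C'. w * trsum C y = w)"

lemma alternatesD: "alternates w C \<Longrightarrow> x \<in> C \<Longrightarrow> y \<in> C \<Longrightarrow> x \<noteq> y \<Longrightarrow> w * tr x y = - w"
  by (auto simp: alternates_def)

lemma garnirD: "garnir w C C' \<Longrightarrow> y \<in> C' \<Longrightarrow> w * trsum C y = w"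
  by (auto simp: garnir_def)

lemma alternates_subset: "alternates w C \<Longrightarrow> C' \<subseteq> C \<Longrightarrow> alternates w C'"
  by (auto simp: alternates_def)

lemma garnir_subset: "garnir w A B \<Longrightarrow> B' \<subseteq> B \<Longrightarrow> garnir w A B'"
  by (auto simp: garnir_def)

lemma alternates_mult:
  assumes "alternates w C" "\<And>x y. x \<in> C \<Longrightarrow> y \<in> C \<Longrightarrow> commutes (tr x y) f"
  shows "alternates (w * f) C"
  unfolding alternates_def
proof (intro ballI impI)
  fix x y assume xy: "x \<in> C" "y \<in> C" "x \<noteq> y"
  have "w * f * tr x y = w * tr x y * f"
    using assms(2)[OF xy(1,2)] by (rule commutes_right[OF commutes_sym])
  then show "w * f * tr x y = - (w * f)"
    using xy assms(1) by (simp add: alternatesD)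
qed

lemma garnir_mult:
  assumes "garnir w A B" "\<And>x y. x \<in> A \<Longrightarrow> y \<in> B \<Longrightarrow> commutes (tr x y) f"
  shows "garnir (w * f) A B"
  unfolding garnir_def
proof
  fix y assume y: "y \<in> B"
  have "commutes f (trsum A y)"
    unfolding trsum_def using assms(2)[OF _ y] by (blast intro: commutes_sum commutes_sym)
  then have "w * f * trsum A y = w * trsum A y * f"
    by (rule commutes_right)
  then show "w * f * trsum A y = w * f"
    by (simp add: garnirD[OF assms(1) y])
qed

lemma mult_trsum_mult: "w * trsum C y * f = (\<Sum>x\<in>C. w * tr x y * f)"
  by (simp add: trsum_def sum_distrib_left sum_distrib_right)

text \<open>Expand \<open>w\<close> as the sum of \<open>w * tr x y\<close> over x in
  \<open>B\<close>. Moving \<open>trsum A y\<close> to the left of \<open>tr x y\<close> turns it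
  into \<open>trsum A x\<close>, which \<open>w\<close> absorbs; disjointness ensures that
  \<open>tr x y\<close> leaves \<open>A\<close> alone.\<close>

lemma garnir_trans:
  assumes "garnir w A B" "garnir w B C" "A \<inter> B = {}" "A \<inter> C = {}"
  shows "garnir w A C"
  unfolding garnir_def
proof
  fix y assume y: "y \<in> C"
  have *: "w * (tr x y * trsum A y) = w * tr x y" if x: "x \<in> B" for x
  proof -
    have "transpose x y ` A = A"
      using assms x y by (auto simp: transpose_def image_iff)
    then have "tr x y * trsum A y = trsum A x * tr x y"
      by (simp add: tr_mult_trsum)
    from mult_eq_left[OF this, of w] show ?thesis
      using garnirD[OF assms(1) x] by (simp flip: mult.assoc)
  qed
  have "w * trsum A y = w * trsum B y * trsum A y"
    using garnirD[OF assms(2) y] by simp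
  also have "\<dots> = (\<Sum>x\<in>B. w * (tr x y * trsum A y))"
    by (simp add: trsum_def[of B] sum_distrib_left sum_distrib_right mult.assoc)
  also have "\<dots> = w * trsum B y"
    using * by (simp add: trsum_def[of B] sum_distrib_left)
  finally show "w * trsum A y = w"
    using garnirD[OF assms(2) y] by simp
qed

lemma image_transpose_outside: "p \<notin> C \<Longrightarrow> q \<notin> C \<Longrightarrow> transpose p q ` C = C"
  by (auto simp: transpose_def image_iff)

lemma tr_mult_trsum_shift:
  "y \<notin> C \<Longrightarrow> z \<notin> C \<Longrightarrow> tr y z * trsum C y = trsum C z * tr y z"
  by (simp add: tr_mult_trsum image_transpose_outside)

lemma alternates_trsum:
  assumes "alternates w (insert a D)" "a \<notin> D" "finite D"
  shows "w * trsum D a = - (of_nat (card D) * w)"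
proof -
  have "w * trsum D a = (\<Sum>d\<in>D. - w)"
    unfolding trsum_def sum_distrib_left
    using assms by (intro sum.cong) (auto simp: alternates_def)
  then show ?thesis by simp
qed

text \<open>The product is a 3-cycle, which can be written with the transposition (y x) inside the
  column in front.\<close>

lemma alternates_cycle:
  assumes "alternates w C" "x \<in> C" "y \<in> C" "x \<noteq> y" "a \<notin> C"
  shows "w * tr y a * tr x a = - (w * tr y a)"
proof -
  have "tr y a * tr x a = tr y x * tr y a"
    unfolding tr_sym[of x a] using assms by (intro tr_cycle) auto
  from mult_eq_left[OF this, of w] have "w * tr y a * tr x a = w * tr y x * tr y a" .
  then show ?thesis using assms by (simp add: alternatesD)
qed

text \<open>With z = \<open>trsum P a\<close> this is w (z - 1) (z + card P) = 0. The diagonal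
  products (b a)(b a) are 1, and \<open>alternates_cycle\<close> turns each of the others into - (b
  a).\<close>

lemma alternates_trsum_square:
  assumes "alternates w P" "finite P" "a \<notin> P"
  shows "w * trsum P a * trsum P a =
    of_nat (card P) * w - (of_nat (card P) - 1) * (w * trsum P a)"
proof -
  have *: "w * tr b a * trsum P a = w - (of_nat (card P) - 1) * (w * tr b a)" if b: "b \<in> P" for b
  proof -
    have "w * tr b a * trsum P a = w * tr b a * tr b a + (\<Sum>x\<in>P - {b}. w * tr b a * tr x a)"
      unfolding trsum_def sum_distrib_left using assms b by (subst sum.remove[of P b]) auto
    also have "(\<Sum>x\<in>P - {b}. w * tr b a * tr x a) = (\<Sum>x\<in>P - {b}. - (w * tr b a))"
      using assms b by (intro sum.cong refl alternates_cycle[OF assms(1)]) auto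
    also have "\<dots> = - ((of_nat (card P) - 1) * (w * tr b a))"
    proof -
      have card: "card P = Suc (card (P - {b}))"
        using assms(2) b by (rule card.remove)
      show ?thesis by (subst card) simp
    qed
    finally show ?thesis by (simp add: mult.assoc tr_square)
  qed
  have "w * trsum P a * trsum P a = (\<Sum>b\<in>P. w - (of_nat (card P) - 1) * (w * tr b a))"
    unfolding mult_trsum_mult by (intro sum.cong refl *)
  also have "\<dots> = of_nat (card P) * w - (of_nat (card P) - 1) * (w * trsum P a)"
    by (simp add: sum_subtractf trsum_def sum_distrib_left)
  finally show ?thesis .
qed

section \<open>Linear factors attached to a column\<close>

definition factor :: "'k::field_char_0 \<Rightarrow> nat set \<Rightarrow> nat \<Rightarrow> 'k group_alg" where
  "factor \<rho> C a = 1 - scal (1 / \<rho>) * trsum C a"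

lemma mult_factor: "w * factor \<rho> C a = w - scal (1 / \<rho>) * (w * trsum C a)"
  by (simp add: factor_def algebra_simps scal_left_commute)

lemma commutes_tr_factor_outside:
  "x \<notin> insert a C \<Longrightarrow> y \<notin> insert a C \<Longrightarrow> commutes (tr x y) (factor \<rho> C a)"
  unfolding factor_def
  by (intro commutes_diff commutes_mult commutes_one commutes_scal commutes_tr_trsum_outside) auto

lemma commutes_tr_factor_inside:
  "x \<in> C \<Longrightarrow> y \<in> C \<Longrightarrow> a \<notin> C \<Longrightarrow> commutes (tr x y) (factor \<rho> C a)"
  unfolding factor_def
  by (intro commutes_diff commutes_mult commutes_one commutes_scal commutes_tr_trsum_inside) auto

lemma tr_mult_factor:
  assumes "a \<notin> C" "b \<notin> C"
  shows "tr a b * factor \<rho> C a = factor \<rho> C b * tr a b"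
proof -
  have "tr a b * (scal (1 / \<rho>) * trsum C a) = scal (1 / \<rho>) * trsum C b * tr a b"
    using assms by (simp add: scal_left_commute tr_mult_trsum_shift mult.assoc)
  then show ?thesis by (simp add: factor_def algebra_simps)
qed

lemma tr_mult_factors:
  assumes "\<And>c. c \<in> set cs \<Longrightarrow> a \<notin> C c \<and> b \<notin> C c"
  shows "tr a b * prod_list (map (\<lambda>c. factor (\<rho> c) (C c) a) cs) =
    prod_list (map (\<lambda>c. factor (\<rho> c) (C c) b) cs) * tr a b"
  using assms
proof (induction cs)
  case (Cons c cs)
  then have "tr a b * factor (\<rho> c) (C c) a = factor (\<rho> c) (C c) b * tr a b"
    by (intro tr_mult_factor) auto
  then have "tr a b * prod_list (map (\<lambda>c. factor (\<rho> c) (C c) a) (c # cs)) =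
      factor (\<rho> c) (C c) b * (tr a b * prod_list (map (\<lambda>c. factor (\<rho> c) (C c) a) cs))"
    by (simp flip: mult.assoc)
  with Cons show ?case by (simp add: mult.assoc)
qed simp

lemma garnir_mult_factors:
  assumes "\<And>c. c \<in> set cs \<Longrightarrow> w * trsum (C c) b = w"
  shows "w * prod_list (map (\<lambda>c. factor (\<rho> c) (C c) b) cs) = scal (\<Prod>c\<leftarrow>cs. 1 - 1 / \<rho> c) * w"
  using assms
proof (induction cs)
  case (Cons c cs)
  have "w * factor (\<rho> c) (C c) b = scal (1 - 1 / \<rho> c) * w"
    using Cons.prems by (simp add: mult_factor scal_diff algebra_simps)
  then have "w * prod_list (map (\<lambda>c. factor (\<rho> c) (C c) b) (c # cs)) =
      scal (1 - 1 / \<rho> c) * (w * prod_list (map (\<lambda>c. factor (\<rho> c) (C c) b) cs))"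
    by (simp flip: mult.assoc)
  also have "\<dots> = scal (\<Prod>c\<leftarrow>c # cs. 1 - 1 / \<rho> c) * w"
    using Cons by (simp add: scal_mult mult.assoc)
  finally show ?case .
qed simp

text \<open>Without \<open>a\<close> in the left column, the exchange relation for y fails by the
  defect \<open>w * tr y a\<close>. Multiplying \<open>w * trsum C a\<close> by
  \<open>trsum D y\<close> reproduces \<open>w * trsum C a\<close> up to a multiple of the same
  defect. Its coefficient collects - card D from b = y, card C - 1 from the b \<noteq> y, and -1
  from completing the sum over b: in total -\<rho>. The coefficient 1/\<rho> in the factor therefore
  cancels the defect.\<close>

lemma garnir_factor_corner:
  assumes fin: "finite C" "finite D" and a: "a \<notin> C" "a \<notin> D" and disj: "D \<inter> C = {}"
    and w: "alternates w (insert a D)" "alternates w C" "garnir w (insert a D) C"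
    and \<rho>: "\<rho> = 2 + of_nat (card D) - of_nat (card C)" "\<rho> \<noteq> 0"
  shows "garnir (w * factor \<rho> C a) D C"
  unfolding garnir_def
proof
  fix y assume y: "y \<in> C"
  have ya: "y \<noteq> a" "y \<notin> D" using y a disj by auto
  have g1: "w * trsum D y = w - w * tr y a"
    using garnirD[OF w(3) y] fin a by (simp add: trsum_insert distrib_left tr_sym algebra_simps)
  \<comment> \<open>Here \<open>trsum D y\<close> can be moved past (b a); its defect then becomes w
    (y a)(b a), which alternation under \<open>C\<close> reduces to - w (y a).\<close>
  have g2: "w * tr b a * trsum D y = w * tr b a + w * tr y a" if b: "b \<in> C - {y}" for b
  proof -
    have "commutes (tr b a) (trsum D y)"
      using b a disj ya by (intro commutes_tr_trsum_outside) auto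
    then have "w * tr b a * trsum D y = w * trsum D y * tr b a"
      by (rule commutes_right)
    also have "\<dots> = w * tr b a - w * tr y a * tr b a"
      by (simp add: g1 left_diff_distrib)
    also have "w * tr y a * tr b a = - (w * tr y a)"
      using b y a by (intro alternates_cycle[OF w(2)]) auto
    finally show ?thesis by simp
  qed
  have g3: "w * tr y a * trsum D y = - (of_nat (card D) * (w * tr y a))"
  proof -
    have "w * tr y a * trsum D y = w * trsum D a * tr y a"
      using ya a by (simp add: mult.assoc tr_mult_trsum_shift)
    then show ?thesis using alternates_trsum[OF w(1) a(2) fin(2)] by (simp add: mult.assoc)
  qed
  have "w * trsum C a * trsum D y = (\<Sum>b\<in>C. w * tr b a * trsum D y)"
    by (simp add: trsum_def[of C a] sum_distrib_left sum_distrib_right)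
  also have "\<dots> = w * tr y a * trsum D y + (\<Sum>b\<in>C - {y}. w * tr b a * trsum D y)"
    using fin y by (simp add: sum.remove)
  also have "(\<Sum>b\<in>C - {y}. w * tr b a * trsum D y) = (\<Sum>b\<in>C - {y}. w * tr b a + w * tr y a)"
    by (intro sum.cong refl g2)
  also have "\<dots> = (\<Sum>b\<in>C - {y}. w * tr b a) + of_nat (card C - 1) * (w * tr y a)"
    using fin y by (simp add: sum.distrib card_Diff_singleton)
  also have "(\<Sum>b\<in>C - {y}. w * tr b a) = w * trsum C a - w * tr y a"
    using fin y by (simp add: trsum_def sum_distrib_left sum_diff1)
  also have "of_nat (card C - 1) = scal (of_nat (card C) - 1)"
    using fin y by (subst of_nat_diff) (auto simp: Suc_le_eq card_gt_0_iff scal_diff)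
  finally have "w * trsum C a * trsum D y =
      - (of_nat (card D) * (w * tr y a)) +
      (w * trsum C a - w * tr y a + scal (of_nat (card C) - 1) * (w * tr y a))"
    unfolding g3 .
  then have g: "w * trsum C a * trsum D y = w * trsum C a - scal \<rho> * (w * tr y a)"
    by (simp add: \<rho>(1) scal_diff scal_add algebra_simps mult_2)
  have "w * factor \<rho> C a * trsum D y = w * trsum D y - scal (1 / \<rho>) * (w * trsum C a * trsum D y)"
    by (simp add: mult_factor left_diff_distrib mult.assoc)
  also have "\<dots> = w - w * tr y a - scal (1 / \<rho>) * (w * trsum C a) + scal (1 / \<rho> * \<rho>) * (w * tr y a)"
    unfolding g g1 scal_mult by (simp add: algebra_simps)
  also have "\<dots> = w * factor \<rho> C a"
    using \<rho>(2) by (simp add: mult_factor)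
  finally show "w * factor \<rho> C a * trsum D y = w * factor \<rho> C a" .
qed

text \<open>Either factor alone spoils the relation between \<open>P\<close> and \<open>Q\<close>.
  All defects are multiples of the same element \<open>d\<close>, with total coefficient -1/p + 1/q
  + (card P - card Q + 1)/(p q), and the condition on q - p makes this zero.\<close>

lemma garnir_factor_factor:
  assumes fin: "finite P" "finite Q" and a: "a \<notin> P" "a \<notin> Q" and disj: "P \<inter> Q = {}"
    and w: "alternates w P" "alternates w Q" "garnir w P Q"
    and pq: "q - p = of_nat (card P) - of_nat (card Q) + 1" "p \<noteq> 0" "q \<noteq> 0"
  shows "garnir (w * factor p P a * factor q Q a) P Q"
  unfolding garnir_def
proof
  fix y assume y: "y \<in> Q"
  have ya: "y \<noteq> a" "y \<notin> P" using y a disj by auto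
  define G where "G = (trsum P y :: 'a group_alg)"
  define z where "z = (trsum P a :: 'a group_alg)"
  define t where "t = (tr y a :: 'a group_alg)"
  have wG: "w * G = w" using garnirD[OF w(3) y] by (simp add: G_def)
  have tG: "t * G = z * t"
    using ya a by (simp add: t_def G_def z_def tr_mult_trsum_shift)
  have cG: "v * tr b a * G = v * G * tr b a" if "b \<in> Q - {y}" for b v
    using that a disj ya unfolding G_def
    by (intro commutes_right commutes_tr_trsum_outside) auto
  have sumQ: "f * trsum Q a = (\<Sum>b\<in>Q - {y}. f * tr b a) + f * t" for f
    using fin y by (simp add: trsum_def sum_distrib_left t_def sum.remove[of Q y] distrib_left add.commute)
  have e1: "w * trsum Q a * G = w * trsum Q a - w * t + w * z * t"
  proof -
    have "w * trsum Q a * G = (\<Sum>b\<in>Q - {y}. w * tr b a * G) + w * t * G"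
      by (simp add: sumQ distrib_right sum_distrib_right)
    also have "(\<Sum>b\<in>Q - {y}. w * tr b a * G) = (\<Sum>b\<in>Q - {y}. w * tr b a)"
      by (intro sum.cong refl) (simp add: cG wG)
    finally show ?thesis by (simp add: sumQ tG mult.assoc)
  qed
  \<comment> \<open>Although \<open>z\<close> does not commute with \<open>G\<close>, the sum z + t
    does: it is \<open>trsum (insert y P) a\<close>, while \<open>G\<close> consists of
    transpositions inside \<open>insert y P\<close>.\<close>
  have e2: "w * z * G = w * z + w * t - w * z * t"
  proof -
    have "commutes G (z + t)"
    proof -
      have "z + t = trsum (insert y P) a"
        using fin ya by (simp add: z_def t_def trsum_insert add.commute)
      moreover have "commutes (trsum (insert y P) a) G"
        unfolding G_def trsum_def[of P y] using a ya
        by (intro commutes_sum commutes_sym[OF commutes_tr_trsum_inside]) auto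
      ultimately show ?thesis by (simp add: commutes_sym)
    qed
    then have "z * G = G * z + G * t - z * t"
      using tG by (simp add: commutes_def algebra_simps)
    then have "w * (z * G) = w * (G * z + G * t - z * t)" by simp
    then have "w * (z * G) = w * G * z + w * G * t - w * (z * t)"
      by (simp add: algebra_simps)
    then show ?thesis by (simp add: wG mult.assoc)
  qed
  \<comment> \<open>Since \<open>z\<close> involves no element of \<open>Q\<close>, multiplication
    by 1 - z preserves alternation under \<open>Q\<close>, and the 3-cycle argument applies to the
    product.\<close>
  have e3: "(w - w * z) * t * tr b a = - ((w - w * z) * t)" if b: "b \<in> Q - {y}" for b
  proof -
    have "alternates (w - w * z) Q"
    proof -
      have "alternates (w * (1 - z)) Q"
        using w(2) unfolding z_def using a disj
        by (intro alternates_mult commutes_diff commutes_one commutes_tr_trsum_outside) auto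
      then show ?thesis by (simp add: algebra_simps)
    qed
    from alternates_cycle[OF this] show ?thesis unfolding t_def using b y a by auto
  qed
  have e4: "w * z * trsum Q a * G = w * z * trsum Q a - w * z * t
      - scal (of_nat (card Q) - 1) * (w * t - w * z * t)
      + scal (of_nat (card P)) * (w * t) - scal (of_nat (card P) - 1) * (w * z * t)"
  proof -
    have "w * z * trsum Q a * G = (\<Sum>b\<in>Q - {y}. w * z * tr b a * G) + w * z * t * G"
      by (simp add: sumQ distrib_right sum_distrib_right)
    also have "(\<Sum>b\<in>Q - {y}. w * z * tr b a * G) =
        (\<Sum>b\<in>Q - {y}. w * z * tr b a - (w * t - w * z * t))"
    proof (intro sum.cong refl)
      fix b assume b: "b \<in> Q - {y}"
      have "w * z * tr b a * G = w * z * G * tr b a"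
        using b by (rule cG)
      also have "\<dots> = w * z * tr b a + (w - w * z) * t * tr b a"
        unfolding e2 by (simp add: algebra_simps)
      finally show "w * z * tr b a * G = w * z * tr b a - (w * t - w * z * t)"
        unfolding e3[OF b] by (simp add: algebra_simps)
    qed
    also have "\<dots> = (\<Sum>b\<in>Q - {y}. w * z * tr b a) - of_nat (card Q - 1) * (w * t - w * z * t)"
      using fin y by (simp add: sum_subtractf card_Diff_singleton)
    also have "of_nat (card Q - 1) = scal (of_nat (card Q) - 1)"
      using fin y by (subst of_nat_diff) (auto simp: Suc_le_eq card_gt_0_iff scal_diff)
    also have "(\<Sum>b\<in>Q - {y}. w * z * tr b a) = w * z * trsum Q a - w * z * t"
      by (simp add: sumQ)
    also have "w * z * t * G = w * z * z * t"
      by (simp add: tG mult.assoc)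
    also have "w * z * z = scal (of_nat (card P)) * w - scal (of_nat (card P) - 1) * (w * z)"
      using alternates_trsum_square[OF w(1) fin(1) a(1)] by (simp add: z_def scal_diff)
    finally show ?thesis by (simp add: left_diff_distrib mult.assoc algebra_simps)
  qed
  define d where "d = w * t - w * z * t"
  have W: "w * factor p P a * factor q Q a =
      w - scal (1 / p) * (w * z) - scal (1 / q) * (w * trsum Q a) + scal (1 / q * (1 / p)) * (w * z * trsum Q a)"
    unfolding mult_factor z_def scal_mult
    by (simp add: left_diff_distrib right_diff_distrib mult.assoc)
  have "w * factor p P a * factor q Q a * G - w * factor p P a * factor q Q a =
      - (scal (1 / p) * d) + scal (1 / q) * d
      + scal (1 / q * (1 / p)) * (scal (of_nat (card P)) * d - scal (of_nat (card Q) - 1) * d)"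
    unfolding W left_diff_distrib distrib_right mult.assoc[of "scal _"] wG e1 e2 e4
    by (simp add: d_def right_diff_distrib distrib_left scal_diff left_diff_distrib)
  also have "\<dots> = scal (- (1 / p) + 1 / q + 1 / q * (1 / p) * (of_nat (card P) - (of_nat (card Q) - 1))) * d"
    by (simp only: scal_add scal_minus scal_mult scal_diff left_diff_distrib right_diff_distrib
        distrib_right mult_minus_left mult.assoc)
  also have "- (1 / p) + 1 / q + 1 / q * (1 / p) * (of_nat (card P) - (of_nat (card Q) - 1)) = 0"
  proof -
    have *: "of_nat (card P) - (of_nat (card Q) - 1) = q - p" using pq(1) by simp
    show ?thesis unfolding * using pq(2,3) by (simp add: field_simps)
  qed
  finally show "w * factor p P a * factor q Q a * trsum P y = w * factor p P a * factor q Q a"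
    by (simp add: G_def)
qed

text \<open>Here d is the row mate of b in the column of a. Pull (b d) out of \<open>R\<close>, move
  it past \<open>f\<close>, and rewrite (a b)(b d) as (a d)(a b). Since w (a d) = -w, the product
  equals its own negative.\<close>

lemma alternates_row_vanish:
  assumes w: "alternates w (insert a D)" and d: "d \<in> D" and a: "a \<notin> D" and b: "b \<notin> insert a D"
    and f: "commutes (tr b d) f" and R: "tr b d * R = R"
  shows "w * tr b a * f * R = 0"
proof -
  have "w * tr b a * f * R = w * tr b a * (f * tr b d) * R"
    by (simp add: R mult.assoc)
  also have "\<dots> = w * (tr a b * tr b d) * f * R"
    using f by (simp add: commutes_def tr_sym mult.assoc)
  also have "tr a b * tr b d = tr a d * tr a b"
    using d a b by (intro tr_cycle) auto
  also have "w * (tr a d * tr a b) * f * R = w * tr a d * tr b a * f * R"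
    by (simp add: tr_sym[of b a] mult.assoc)
  also have "w * tr a d = - w"
    using w d a by (intro alternatesD[OF w]) auto
  also have "- w * tr b a * f * R = - (w * tr b a * f * R)" by simp
  finally show ?thesis using eq_uminus_self_iff by blast
qed

text \<open>Every term that begins with (b a) from the first factor vanishes by
  \<open>alternates_row_vanish\<close>, where \<open>f\<close> is the product of the remaining
  factors. As the columns are distinct and disjoint, b occurs in none of these factors, so (b d)
  commutes with \<open>f\<close>.\<close>

lemma alternates_factors_absorb:
  assumes w: "alternates w (insert a D)" and a: "a \<notin> D"
    and R: "\<And>c b. c \<in> set cs \<Longrightarrow> b \<in> C c \<Longrightarrow> b \<notin> insert a D \<and> (\<exists>d\<in>D. tr b d * R = R)"
    and disj: "\<And>c c'. c \<noteq> c' \<Longrightarrow> C c \<inter> C c' = {}" and cs: "distinct cs"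
  shows "w * prod_list (map (\<lambda>c. factor (\<rho> c) (C c) a) cs) * R = w * R"
  using R cs
proof (induction cs)
  case (Cons c cs)
  let ?f = "prod_list (map (\<lambda>c. factor (\<rho> c) (C c) a) cs)"
  have "w * tr b a * ?f * R = 0" if b: "b \<in> C c" for b
  proof -
    obtain d where d: "d \<in> D" "tr b d * R = R" "b \<notin> insert a D"
      using Cons.prems(1)[of c b] b by auto
    have "commutes (tr b d) ?f"
    proof (rule commutes_prod_list)
      fix g assume "g \<in> set (map (\<lambda>c. factor (\<rho> c) (C c) a) cs)"
      then obtain c' where c': "c' \<in> set cs" "g = factor (\<rho> c') (C c') a" by auto
      then have "b \<notin> C c'" using disj[of c c'] b Cons.prems(2) by auto
      moreover have "d \<notin> C c'" using Cons.prems(1)[of c' d] d c' by auto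
      ultimately show "commutes (tr b d) g"
        using d a c' by (auto intro!: commutes_tr_factor_outside)
    qed
    then show ?thesis using d w a by (intro alternates_row_vanish) auto
  qed
  then have "w * trsum (C c) a * ?f * R = 0"
    by (simp add: trsum_def sum_distrib_left sum_distrib_right)
  then have "w * factor (\<rho> c) (C c) a * ?f * R = w * ?f * R"
    by (simp add: mult_factor left_diff_distrib mult.assoc)
  moreover have "w * ?f * R = w * R"
    by (rule Cons.IH) (use Cons.prems in auto)
  ultimately show ?case by (simp add: mult.assoc)
qed simp

text \<open>
  In a run of columns of equal length the exchange relation also holds with the two columns
  interchanged, so \<open>w * trsum (C c) a * trsum (C c') a = w * trsum (C c) a\<close> for \<open>c < c'\<close>, which
  telescopes the product of the column factors.
\<close>

lemma factors_collapse:
  assumes "p \<le> t"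
    and a: "\<And>c. p \<le> c \<Longrightarrow> c \<le> t \<Longrightarrow> a \<notin> C c"
    and disj: "\<And>c c'. c \<noteq> c' \<Longrightarrow> C c \<inter> C c' = {}"
    and w: "\<And>c c'. p \<le> c \<Longrightarrow> c < c' \<Longrightarrow> c' \<le> t \<Longrightarrow> garnir w (C c') (C c)"
    and \<rho>: "\<And>c. p \<le> c \<Longrightarrow> c < t \<Longrightarrow> \<rho> (Suc c) = \<rho> c + 1"
      "\<And>c. p \<le> c \<Longrightarrow> c \<le> t \<Longrightarrow> \<rho> c \<noteq> 0"
  shows "w * prod_list (map (\<lambda>c. factor (\<rho> c) (C c) a) [p..<Suc t]) =
    w - scal (1 / \<rho> t) * (w * (\<Sum>c = p..t. trsum (C c) a))"
  using assms
proof (induction t rule: dec_induct)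
  case base
  then show ?case by (simp add: mult_factor)
next
  case (step t)
  let ?X = "\<Sum>c = p..t. trsum (C c) a" and ?z = "trsum (C (Suc t)) a"
  have "w * trsum (C c) a * ?z = w * trsum (C c) a" if c: "c \<in> {p..t}" for c
  proof -
    have "w * tr b a * ?z = w * tr b a" if b: "b \<in> C c" for b
    proof -
      have "b \<notin> C (Suc t)" using step.prems(2)[of c "Suc t"] b c by auto
      moreover have "a \<notin> C (Suc t)" using step.prems(1) step.hyps by simp
      ultimately have "w * tr a b * ?z = w * trsum (C (Suc t)) b * tr a b"
        by (intro mult_eq_left tr_mult_trsum_shift)
      moreover have "w * trsum (C (Suc t)) b = w"
        using step.prems(3)[of c "Suc t"] b c by (auto intro: garnirD)
      ultimately show ?thesis by (simp add: tr_sym[of b a])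
    qed
    then show ?thesis by (simp add: trsum_def[of "C c"] sum_distrib_left sum_distrib_right)
  qed
  then have X: "w * ?X * ?z = w * ?X"
    by (simp add: sum_distrib_left sum_distrib_right)
  have nz: "\<rho> t \<noteq> 0" "\<rho> (Suc t) \<noteq> 0" "\<rho> (Suc t) = \<rho> t + 1"
    using step.prems(4)[of t] step.prems(5)[of t] step.prems(5)[of "Suc t"] step.hyps by auto
  have "w * prod_list (map (\<lambda>c. factor (\<rho> c) (C c) a) [p..<Suc (Suc t)]) =
      (w - scal (1 / \<rho> t) * (w * ?X)) * factor (\<rho> (Suc t)) (C (Suc t)) a"
    using step by (simp flip: mult.assoc)
  also have "\<dots> = w - scal (1 / \<rho> t) * (w * ?X) - scal (1 / \<rho> (Suc t)) * (w * ?z)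
      + scal (1 / \<rho> (Suc t) * (1 / \<rho> t)) * (w * ?X * ?z)"
    unfolding mult_factor scal_mult
    by (simp add: left_diff_distrib right_diff_distrib mult.assoc)
  also have "\<dots> = w - scal (1 / \<rho> t - 1 / \<rho> (Suc t) * (1 / \<rho> t)) * (w * ?X) - scal (1 / \<rho> (Suc t)) * (w * ?z)"
    unfolding X scal_diff by (simp add: left_diff_distrib)
  \<comment> \<open>As the weights increase by 1, the earlier columns receive exactly the
    coefficient of the newest one; so only the last weight of the run remains.\<close>
  also have "1 / \<rho> t - 1 / \<rho> (Suc t) * (1 / \<rho> t) = 1 / \<rho> (Suc t)"
    using nz(1,2) by (simp add: divide_simps) (simp add: nz(3))
  also have "w - scal (1 / \<rho> (Suc t)) * (w * ?X) - scal (1 / \<rho> (Suc t)) * (w * ?z) =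
      w - scal (1 / \<rho> (Suc t)) * (w * (\<Sum>c = p..Suc t. trsum (C c) a))"
    using step.hyps by (simp add: distrib_left)
  finally show ?case .
qed

section \<open>Removing a corner\<close>

text \<open>No shape is mentioned and empty columns are allowed, so that removing a box is a mere
  function update of \<open>C\<close>. Relations between distant columns follow by
  \<open>garnir_trans\<close>.\<close>

definition specht_rel :: "'k::field_char_0 group_alg \<Rightarrow> (nat \<Rightarrow> nat set) \<Rightarrow> bool" where
  "specht_rel w C \<longleftrightarrow> (\<forall>j\<ge>1. alternates w (C j) \<and> garnir w (C j) (C (Suc j)))"

lemma specht_rel_garnir:
  assumes "specht_rel w C" "1 \<le> i" "i < j" and disj: "\<And>c c'. c \<noteq> c' \<Longrightarrow> C c \<inter> C c' = {}"
  shows "garnir w (C i) (C j)"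
proof -
  from \<open>i < j\<close> have "Suc i \<le> j" by simp
  then show ?thesis
  proof (induction j rule: dec_induct)
    case base
    then show ?case using assms by (simp add: specht_rel_def)
  next
    case (step j)
    then have "garnir w (C j) (C (Suc j))"
      using assms by (simp add: specht_rel_def)
    with step.IH show ?case
      by (rule garnir_trans) (use step.hyps in \<open>auto intro!: disj\<close>)
  qed
qed

text \<open>The axial distance between the bottom boxes of the columns c and v. If c is the last
  column of its length, it is the hook length at row \<open>card (C c)\<close> of column v after the
  corner has been removed.\<close>

definition corner_weight :: "(nat \<Rightarrow> nat set) \<Rightarrow> nat \<Rightarrow> nat \<Rightarrow> 'k::field_char_0" where
  "corner_weight C v c = of_nat (c - v + card (C v)) - of_nat (card (C c))"

definition corner_prod :: "(nat \<Rightarrow> nat set) \<Rightarrow> nat \<Rightarrow> nat \<Rightarrow> nat \<Rightarrow> 'k::field_char_0 group_alg" where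
  "corner_prod C v N a = prod_list (map (\<lambda>c. factor (corner_weight C v c) (C c) a) [Suc v..<Suc N])"

lemma commutes_tr_factors:
  assumes "\<And>c. c \<in> set cs \<Longrightarrow> x \<notin> insert a (C c) \<and> y \<notin> insert a (C c)"
  shows "commutes (tr x y) (prod_list (map (\<lambda>c. factor (\<rho> c) (C c) a) cs))"
  using assms by (intro commutes_prod_list) (auto intro!: commutes_tr_factor_outside)

text \<open>Only the columns are kept: rows matter neither for the relations nor for the scalar in
  \<open>corner_prod_alternate\<close>. The condition \<open>card_less\<close> says that nothing
  lies to the right of the bottom box of column v, and it makes all weights positive.\<close>

locale column_corner =
  fixes C :: "nat \<Rightarrow> nat set" and v a :: nat
  assumes fin: "finite (C c)"
    and disj: "c \<noteq> c' \<Longrightarrow> C c \<inter> C c' = {}"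
    and a: "a \<in> C v"
    and v: "1 \<le> v"
    and card_less: "v < c \<Longrightarrow> card (C c) < card (C v)"
begin

abbreviation D where "D \<equiv> C v - {a}"

lemma a_notin: "c \<noteq> v \<Longrightarrow> a \<notin> C c"
  using disj[of c v] a by auto

lemma notin_other: "x \<in> C c \<Longrightarrow> c \<noteq> c' \<Longrightarrow> x \<notin> C c'"
  using disj[of c c'] by auto

lemma insert_D: "insert a D = C v"
  using a by auto

lemma card_D: "card (C v) = Suc (card D)"
  using fin a by (rule card.remove)

lemma corner_weight_nat:
  "v < c \<Longrightarrow> corner_weight C v c = of_nat (c - v + card (C v) - card (C c))"
  using card_less[of c] by (simp add: corner_weight_def of_nat_diff)

lemma corner_weight_nonzero: "v < c \<Longrightarrow> corner_weight C v c \<noteq> 0"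
  unfolding corner_weight_nat of_nat_eq_0_iff using card_less[of c] by simp

lemma corner_weight_Suc:
  "v < c \<Longrightarrow> corner_weight C v (Suc c) - corner_weight C v c =
     of_nat (card (C c)) - of_nat (card (C (Suc c))) + 1"
  by (simp add: corner_weight_def Suc_diff_le)

lemma corner_prod_Suc:
  "v \<le> N \<Longrightarrow> corner_prod C v (Suc N) a =
     corner_prod C v N a * factor (corner_weight C v (Suc N)) (C (Suc N)) a"
  by (simp add: corner_prod_def)

text \<open>A transposition inside a column commutes with all factors, so alternation survives. One
  between columns j and j + 1 commutes with the factors of all other columns, so each exchange
  relation has to be checked only against the factors of its own two columns.\<close>

lemma corner_prod_relations:
  fixes w :: "'k::field_char_0 group_alg"
  assumes w: "specht_rel w C" and empty: "\<And>c. N < c \<Longrightarrow> C c = {}"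
  shows "specht_rel (w * corner_prod C v N a) (C(v := D))"
  unfolding specht_rel_def
proof (intro allI impI conjI)
  fix j :: nat assume j: "1 \<le> j"
  let ?C = "C(v := D)"
  let ?F = "\<lambda>c. factor (corner_weight C v c) (C c) a :: 'k group_alg"
  have sub: "?C j \<subseteq> C j" "?C (Suc j) \<subseteq> C (Suc j)" by auto
  have na: "a \<notin> ?C i" for i using a_notin[of i] by auto
  have alt: "alternates w (C i)" and gar: "garnir w (C i) (C (Suc i))" if "1 \<le> i" for i
    using w that by (auto simp: specht_rel_def)
  have inside: "commutes (tr x y) (prod_list (map ?F cs))"
    if "x \<in> ?C i" "y \<in> ?C i" "\<And>c. c \<in> set cs \<Longrightarrow> v < c" for x y i cs
  proof (rule commutes_prod_list)
    fix g assume "g \<in> set (map ?F cs)"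
    then obtain c where "c \<in> set cs" and g: "g = ?F c" by auto
    with that(3) have c: "v < c" "g = ?F c" by auto
    have xy: "x \<in> C i" "y \<in> C i" "x \<noteq> a" "y \<noteq> a"
      using that(1,2) na[of i] by (auto split: if_splits)
    show "commutes (tr x y) g"
    proof (cases "c = i")
      case True
      then show ?thesis using c xy a_notin[of c] by (auto intro!: commutes_tr_factor_inside)
    next
      case False
      then show ?thesis using c xy notin_other[of _ i c]
        by (auto intro!: commutes_tr_factor_outside)
    qed
  qed
  have outside: "commutes (tr x y) (prod_list (map ?F cs))"
    if "x \<in> ?C j" "y \<in> ?C (Suc j)" "\<And>c. c \<in> set cs \<Longrightarrow> c \<noteq> j \<and> c \<noteq> Suc j" for x y cs
  proof (rule commutes_tr_factors)
    fix c assume "c \<in> set cs"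
    then show "x \<notin> insert a (C c) \<and> y \<notin> insert a (C c)"
      using that(3)[of c] that(1,2) na sub notin_other[of x j c] notin_other[of y "Suc j" c]
      by (metis insert_iff subsetD)
  qed
  show "alternates (w * corner_prod C v N a) (?C j)"
    unfolding corner_prod_def
    by (rule alternates_mult[OF alternates_subset[OF alt[OF j] sub(1)] inside]) auto
  \<comment> \<open>The relevant factors number none to the left of the corner, one at the corner
    column, and two to its right; an empty column has nothing to exchange.\<close>
  consider "Suc j \<le> v" | "j = v" "Suc v \<le> N" | "v < j" "Suc j \<le> N" | "C (Suc j) = {}"
    using empty[of "Suc j"] by linarith
  then show "garnir (w * corner_prod C v N a) (?C j) (?C (Suc j))"
  proof cases
    case 1
    then have "garnir w (?C j) (?C (Suc j))"
      using garnir_subset[OF gar[OF j] sub(2)] by auto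
    then show ?thesis
      unfolding corner_prod_def using 1 by (intro garnir_mult outside) auto
  next
    case 2
    have "[Suc v..<Suc N] = Suc v # [Suc (Suc v)..<Suc N]"
      using 2 by (subst upt_conv_Cons) auto
    then have W: "w * corner_prod C v N a =
        w * ?F (Suc v) * prod_list (map ?F [Suc (Suc v)..<Suc N])"
      by (simp add: corner_prod_def mult.assoc)
    have "garnir (w * ?F (Suc v)) D (C (Suc v))"
    proof (rule garnir_factor_corner)
      show "corner_weight C v (Suc v) = (2 + of_nat (card D) - of_nat (card (C (Suc v))) :: 'k)"
        unfolding corner_weight_def card_D by simp
      show "corner_weight C v (Suc v) \<noteq> (0 :: 'k)"
        by (rule corner_weight_nonzero) simp
      show "D \<inter> C (Suc v) = {}" using disj[of v "Suc v"] by auto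
    qed (use fin alt[OF v] alt[of "Suc v"] gar[OF v] a_notin[of "Suc v"] in \<open>auto simp: insert_D insert_absorb[OF a]\<close>)
    then have "garnir (w * ?F (Suc v) * prod_list (map ?F [Suc (Suc v)..<Suc N])) D (C (Suc v))"
      by (rule garnir_mult) (rule outside, use 2 in auto)
    then show ?thesis
      unfolding W using 2 by simp
  next
    case 3
    have "[Suc v..<Suc N] = [Suc v..<j] @ [j..<Suc N]"
      using 3 upt_add_eq_append[of "Suc v" j "Suc N - j"] by simp
    also have "[j..<Suc N] = j # Suc j # [Suc (Suc j)..<Suc N]"
      using 3 by (subst upt_conv_Cons, simp, subst upt_conv_Cons) auto
    finally have W: "w * corner_prod C v N a =
        w * prod_list (map ?F [Suc v..<j]) * ?F j * ?F (Suc j) * prod_list (map ?F [Suc (Suc j)..<Suc N])"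
      by (simp add: corner_prod_def mult.assoc)
    let ?w = "w * prod_list (map ?F [Suc v..<j])"
    have C: "?C j = C j" "?C (Suc j) = C (Suc j)" using 3 by auto
    have "garnir (?w * ?F j * ?F (Suc j)) (C j) (C (Suc j))"
    proof (rule garnir_factor_factor)
      show "alternates ?w (C j)"
        by (rule alternates_mult[OF alt[OF j]], rule inside[of _ j]) (use C in auto)
      show "alternates ?w (C (Suc j))"
        by (rule alternates_mult[OF alt], simp, rule inside[of _ "Suc j"]) (use C in auto)
      show "garnir ?w (C j) (C (Suc j))"
        by (rule garnir_mult[OF gar[OF j]], rule outside) (use C in auto)
      show "corner_weight C v (Suc j) - corner_weight C v j =
          (of_nat (card (C j)) - of_nat (card (C (Suc j))) + 1 :: 'k)"
        using 3 by (intro corner_weight_Suc)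
    qed (use 3 fin a_notin disj in \<open>auto intro!: corner_weight_nonzero\<close>)
    then show ?thesis
      unfolding W C by (rule garnir_mult) (rule outside, use C in auto)
  next
    case 4
    then show ?thesis using sub(2) by (auto simp: garnir_def)
  qed
qed

text \<open>Induction on the last column included. Without factors, alternation gives 1 + card D =
  card (C v); afterwards every entry b of a new column contributes the same multiple of
  \<open>w\<close>. If N is the length of the first row, the natural number in the scalar is the
  hook length at the top of column v.\<close>

lemma corner_prod_alternate:
  fixes w :: "'k::field_char_0 group_alg"
  assumes w: "specht_rel w C" and "v \<le> N"
  shows "w * corner_prod C v N a * (1 - trsum D a) =
    scal (of_nat (N - v + card (C v)) * (\<Prod>c\<in>{v<..N}. 1 - 1 / corner_weight C v c)) * w"
  using \<open>v \<le> N\<close>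
proof (induction N rule: dec_induct)
  case base
  have "alternates w (insert a D)"
    unfolding insert_D using w v by (simp add: specht_rel_def)
  then have "w * trsum D a = - (of_nat (card D) * w)"
    using fin by (intro alternates_trsum) auto
  then show ?case by (simp add: corner_prod_def card_D scal_add algebra_simps)
next
  case (step N)
  let ?N = "Suc N"
  let ?P = "corner_prod C v N a :: 'k group_alg"
  let ?p = "(\<Prod>c\<in>{v<..N}. 1 - 1 / corner_weight C v c) :: 'k"
  let ?\<rho> = "corner_weight C v ?N :: 'k"
  \<comment> \<open>The relation of b with column v gives w P (1 - trsum D b) = w (a b) P.
    Conjugating by (a b) centres each factor of \<open>P\<close> at b instead of a, and there
    \<open>w\<close> sees only the scalars 1 - 1/weight.\<close>
  have exchange: "w * ?P * tr b a * (1 - trsum D a) = scal ?p * w" if b: "b \<in> C ?N" for b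
  proof -
    have nb: "b \<notin> C c" if "c \<in> {v..N}" for c using notin_other[OF b, of c] that by auto
    have ba: "b \<noteq> a" "b \<notin> D" using nb[of v] a step.hyps by auto
    have "garnir w (C v) (C ?N)"
      using w v step.hyps disj by (intro specht_rel_garnir) auto
    then have "w * trsum (insert a D) b = w"
      unfolding insert_D using b by (rule garnirD)
    moreover have "trsum (insert a D) b = (tr a b + trsum D b :: 'k group_alg)"
      using fin[of v] by (intro trsum_insert) auto
    ultimately have g: "w * trsum D b = w - w * tr a b"
      by (simp only:) (simp add: algebra_simps)
    have "commutes ?P (trsum D b)"
      unfolding trsum_def corner_prod_def
    proof (intro commutes_sum commutes_sym[OF commutes_tr_factors])
      fix d c assume "d \<in> D" "c \<in> set [Suc v..<Suc N]"
      then show "d \<notin> insert a (C c) \<and> b \<notin> insert a (C c)"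
        using nb[of c] ba notin_other[of d v c] by auto
    qed
    then have "w * ?P * trsum D b = w * trsum D b * ?P"
      by (rule commutes_right)
    also have "\<dots> = w * ?P - w * tr a b * ?P"
      unfolding g by (simp add: left_diff_distrib)
    finally have c: "w * ?P * trsum D b = w * ?P - w * tr a b * ?P" .
    have "w * ?P * tr a b * (1 - trsum D a) = w * ?P * tr a b - w * ?P * (tr a b * trsum D a)"
      by (simp add: right_diff_distrib mult.assoc)
    also have "tr a b * trsum D a = trsum D b * tr a b"
      using ba by (intro tr_mult_trsum_shift) auto
    also have "w * ?P * tr a b - w * ?P * (trsum D b * tr a b) =
        (w * ?P - w * ?P * trsum D b) * tr a b"
      by (simp add: left_diff_distrib mult.assoc)
    also have "\<dots> = w * (tr a b * ?P) * tr a b"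
      unfolding c by (simp add: mult.assoc)
    also have "tr a b * ?P = prod_list (map (\<lambda>c. factor (corner_weight C v c) (C c) b) [Suc v..<Suc N]) * tr a b"
      unfolding corner_prod_def
      by (rule tr_mult_factors) (use a_notin nb in auto)
    also have "w * (prod_list (map (\<lambda>c. factor (corner_weight C v c) (C c) b) [Suc v..<Suc N]) * tr a b) * tr a b =
        w * prod_list (map (\<lambda>c. factor (corner_weight C v c) (C c) b) [Suc v..<Suc N])"
      by (simp add: mult.assoc tr_square)
    also have "\<dots> = scal (\<Prod>c\<leftarrow>[Suc v..<Suc N]. 1 - 1 / corner_weight C v c) * w"
    proof (rule garnir_mult_factors)
      fix c assume "c \<in> set [Suc v..<Suc N]"
      then have "garnir w (C c) (C ?N)"
        using w disj by (intro specht_rel_garnir) auto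
      then show "w * trsum (C c) b = w" using b by (rule garnirD)
    qed
    also have "(\<Prod>c\<leftarrow>[Suc v..<Suc N]. 1 - 1 / corner_weight C v c) = ?p"
      by (subst prod.distinct_set_conv_list[symmetric])
        (auto intro!: prod.cong simp: greaterThanAtMost_def)
    finally show ?thesis by (simp add: tr_sym[of b a])
  qed
  have "w * corner_prod C v ?N a * (1 - trsum D a) =
      w * ?P * (1 - trsum D a) - scal (1 / ?\<rho>) * (w * ?P * trsum (C ?N) a * (1 - trsum D a))"
  proof -
    have "w * corner_prod C v ?N a = w * ?P * factor ?\<rho> (C ?N) a"
      by (simp only: corner_prod_Suc[OF step.hyps(1)] mult.assoc)
    then show ?thesis
      by (simp only: mult_factor left_diff_distrib mult.assoc[of "scal _"])
  qed
  also have "w * ?P * trsum (C ?N) a * (1 - trsum D a) = (\<Sum>b\<in>C ?N. scal ?p * w)"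
    unfolding mult_trsum_mult by (intro sum.cong refl exchange)
  also have "\<dots> = scal (of_nat (card (C ?N)) * ?p) * w"
    by (simp add: scal_mult mult.assoc)
  also have "w * ?P * (1 - trsum D a) = scal (of_nat (N - v + card (C v)) * ?p) * w"
    by (rule step.IH)
  also have "scal (of_nat (N - v + card (C v)) * ?p) * w - scal (1 / ?\<rho>) * (scal (of_nat (card (C ?N)) * ?p) * w) =
      scal (of_nat (N - v + card (C v)) * ?p - 1 / ?\<rho> * (of_nat (card (C ?N)) * ?p)) * w"
    by (simp only: scal_mult scal_diff left_diff_distrib mult.assoc)
  also have "of_nat (N - v + card (C v)) * ?p - 1 / ?\<rho> * (of_nat (card (C ?N)) * ?p) =
      of_nat (?N - v + card (C v)) * (\<Prod>c\<in>{v<..?N}. 1 - 1 / corner_weight C v c)"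
  proof -
    have "{v<..?N} = insert ?N {v<..N}" using step.hyps by auto
    then have *: "(\<Prod>c\<in>{v<..?N}. 1 - 1 / corner_weight C v c) = (1 - 1 / ?\<rho>) * ?p" by simp
    have nz: "?\<rho> \<noteq> 0" using step.hyps by (intro corner_weight_nonzero) simp
    \<comment> \<open>Writing H for N - v + card (C v), the new column has H + 1 - \<rho> entries,
      and H - (H + 1 - \<rho>)/\<rho> = (H + 1)(1 - 1/\<rho>) is the recursion for the
      scalar.\<close>
    have h: "of_nat (card (C ?N)) = of_nat (N - v + card (C v)) + 1 - ?\<rho>"
      using step.hyps by (simp add: corner_weight_def Suc_diff_le)
    have "of_nat (?N - v + card (C v)) = of_nat (N - v + card (C v)) + (1 :: 'k)"
      using step.hyps by (simp add: Suc_diff_le)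
    then show ?thesis unfolding * h using nz by (simp add: field_simps)
  qed
  finally show ?case .
qed

end

section \<open>Partitions and tableaux\<close>

lemma initial_segment:
  fixes A :: "nat set"
  assumes "finite A" "0 \<notin> A" "\<And>i j. j \<in> A \<Longrightarrow> 1 \<le> i \<Longrightarrow> i \<le> j \<Longrightarrow> i \<in> A"
  shows "A = {1..card A}"
proof (cases "A = {}")
  case False
  have "A = {1..Max A}"
  proof
    show "A \<subseteq> {1..Max A}"
      using assms(1,2) by (auto simp: Suc_le_eq intro!: gr0I)
    show "{1..Max A} \<subseteq> A"
      using assms(3)[OF Max_in[OF assms(1) False]] by auto
  qed
  then show ?thesis by (metis card_atLeastAtMost diff_Suc_1 One_nat_def)
qed simp

lemma is_partition_antimono:
  assumes "is_partition lam n" "1 \<le> i" "i \<le> j"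
  shows "lam j \<le> lam i"
  using \<open>i \<le> j\<close>
proof (induction j rule: dec_induct)
  case (step j)
  then show ?case using assms by (auto simp: is_partition_def intro: order_trans)
qed simp

lemma finite_diagram:
  assumes "is_partition lam n"
  shows "finite (diagram lam)"
proof (rule finite_subset)
  show "diagram lam \<subseteq> {i. lam i \<noteq> 0} \<times> {..lam 1}"
    using is_partition_antimono[OF assms, of 1] by (fastforce simp: diagram_def)
  show "finite ({i. lam i \<noteq> 0} \<times> {..lam 1})"
    using assms by (auto simp: is_partition_def)
qed

lemma col_rows:
  assumes "is_partition lam n" "1 \<le> j"
  shows "{i. (i, j) \<in> diagram lam} = {1..col_len lam j}"
  unfolding col_len_def
proof (rule initial_segment)
  have "{i. (i, j) \<in> diagram lam} \<subseteq> fst ` diagram lam" by force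
  then show "finite {i. (i, j) \<in> diagram lam}"
    using finite_diagram[OF assms(1)] by (metis finite_imageI finite_subset)
qed (use is_partition_antimono[OF assms(1)] in \<open>auto simp: diagram_def intro: order_trans\<close>)

lemma diagram_col_iff:
  assumes "is_partition lam n"
  shows "(i, j) \<in> diagram lam \<longleftrightarrow> 1 \<le> j \<and> 1 \<le> i \<and> i \<le> col_len lam j"
proof (cases "1 \<le> j")
  case True
  then show ?thesis using col_rows[OF assms True] by auto
qed (auto simp: diagram_def)

lemma card_hook:
  assumes "is_partition mu k" "(x, y) \<in> diagram mu"
  shows "card (hook mu x y) = mu x - y + (col_len mu y - x) + 1"
proof -
  have xy: "1 \<le> x" "1 \<le> y" "y \<le> mu x" "x \<le> col_len mu y"
    using assms diagram_col_iff[OF assms(1), of x y] by (auto simp: diagram_def)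
  have "hook mu x y = ({x} \<times> {y..mu x}) \<union> ({x..col_len mu y} \<times> {y})"
    unfolding hook_def using xy diagram_col_iff[OF assms(1), of _ y] by (auto simp: diagram_def)
  also have "\<dots> = ({x} \<times> {y..mu x}) \<union> ({Suc x..col_len mu y} \<times> {y})"
    using xy by auto
  also have "card \<dots> = card ({x} \<times> {y..mu x}) + card ({Suc x..col_len mu y} \<times> {y})"
    by (rule card_Un_disjoint) auto
  finally show ?thesis using xy by (simp add: card_cartesian_product)
qed

lemma row_entries_eq: "row_entries lam T i = T ` {p \<in> diagram lam. fst p = i}"
  by (auto simp: row_entries_def)

lemma col_entries_eq: "col_entries lam T j = T ` {p \<in> diagram lam. snd p = j}"
  by (auto simp: col_entries_def)

lemma row_entries_disjoint:
  "inj_on T (diagram lam) \<Longrightarrow> i \<noteq> i' \<Longrightarrow> row_entries lam T i \<inter> row_entries lam T i' = {}"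
  by (auto simp: row_entries_def inj_on_def)

lemma col_entries_disjoint:
  "inj_on T (diagram lam) \<Longrightarrow> j \<noteq> j' \<Longrightarrow> col_entries lam T j \<inter> col_entries lam T j' = {}"
  by (auto simp: col_entries_def inj_on_def)

lemma card_col_entries:
  assumes "inj_on T (diagram lam)"
  shows "card (col_entries lam T j) = col_len lam j"
proof -
  have "col_entries lam T j = (\<lambda>i. T (i, j)) ` {i. (i, j) \<in> diagram lam}"
    by (auto simp: col_entries_def)
  moreover have "inj_on (\<lambda>i. T (i, j)) {i. (i, j) \<in> diagram lam}"
    using assms by (auto simp: inj_on_def)
  ultimately show ?thesis by (simp add: card_image col_len_def)
qed

section \<open>Ordered products of row and column factors\<close>

lemma prod_list_update_left:
  assumes "distinct xs" "x \<in> set xs" "\<And>y. y \<in> set xs \<Longrightarrow> y \<noteq> x \<Longrightarrow> commutes g (f y)"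
  shows "prod_list (map (f(x := g * f x)) xs) = g * (prod_list (map f xs) :: 'a::monoid_mult)"
  using assms
proof (induction xs)
  case (Cons y xs)
  show ?case
  proof (cases "y = x")
    case True
    then have eq: "map (f(x := g * f x)) xs = map f xs"
      using Cons.prems by auto
    show ?thesis by (simp only: True list.map eq prod_list.Cons fun_upd_same mult.assoc)
  next
    case False
    have "prod_list (map (f(x := g * f x)) xs) = g * prod_list (map f xs)"
      by (rule Cons.IH) (use Cons.prems False in auto)
    then have "prod_list (map (f(x := g * f x)) (y # xs)) = f y * g * prod_list (map f xs)"
      by (simp only: list.map prod_list.Cons fun_upd_other[OF False] mult.assoc)
    also have "f y * g = g * f y"
      using Cons.prems(3)[of y] False by (simp add: commutes_def)
    finally show ?thesis by (simp only: list.map prod_list.Cons mult.assoc)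
  qed
qed simp

lemma prod_list_update_right:
  assumes "distinct xs" "x \<in> set xs" "\<And>y. y \<in> set xs \<Longrightarrow> y \<noteq> x \<Longrightarrow> commutes g (f y)"
  shows "prod_list (map (f(x := f x * g)) xs) = (prod_list (map f xs) :: 'a::monoid_mult) * g"
  using assms
proof (induction xs rule: rev_induct)
  case (snoc y xs)
  show ?case
  proof (cases "y = x")
    case True
    then have eq: "map (f(x := f x * g)) xs = map f xs"
      using snoc.prems by auto
    show ?thesis
      by (simp only: True map_append list.map eq prod_list.append prod_list.Cons prod_list.Nil
          fun_upd_same mult_1_right mult.assoc)
  next
    case False
    have "prod_list (map (f(x := f x * g)) xs) = prod_list (map f xs) * g"
      by (rule snoc.IH) (use snoc.prems False in auto)
    then have "prod_list (map (f(x := f x * g)) (xs @ [y])) = prod_list (map f xs) * (g * f y)"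
      by (simp only: map_append list.map prod_list.append prod_list.Cons prod_list.Nil
          fun_upd_other[OF False] mult_1_right mult.assoc)
    also have "g * f y = f y * g"
      using snoc.prems(3)[of y] False by (simp add: commutes_def)
    finally show ?thesis
      by (simp only: map_append list.map prod_list.append prod_list.Cons prod_list.Nil
          mult_1_right mult.assoc)
  qed
qed simp

lemma prod_list_map_upt_extend:
  assumes "m \<le> n" "\<And>i. m < i \<Longrightarrow> f i = (1 :: 'a::monoid_mult)"
  shows "prod_list (map f [1..<Suc n]) = prod_list (map f [1..<Suc m])"
  using assms(1)
proof (induction n rule: dec_induct)
  case (step n)
  then show ?case using assms(2)[of "Suc n"] by simp
qed simp

definition row_prod :: "(nat \<Rightarrow> nat) \<Rightarrow> tableau \<Rightarrow> nat \<Rightarrow> 'k::field_char_0 group_alg" where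
  "row_prod lam T N = (\<Prod>i\<leftarrow>[1..<Suc N]. symmetrizer (row_entries lam T i))"

definition col_prod :: "(nat \<Rightarrow> nat) \<Rightarrow> tableau \<Rightarrow> nat \<Rightarrow> 'k::field_char_0 group_alg" where
  "col_prod lam T M = (\<Prod>j\<leftarrow>[1..<Suc M]. antisymmetrizer (col_entries lam T j))"

lemma row_entries_empty:
  assumes "is_partition lam n" "col_len lam 1 < i"
  shows "row_entries lam T i = {}"
proof -
  have "(i, j) \<notin> diagram lam" for j
    using assms diagram_col_iff[OF assms(1), of i 1] by (auto simp: diagram_def)
  then show ?thesis by (simp add: row_entries_def)
qed

lemma col_entries_empty:
  assumes "is_partition lam n" "lam 1 < j"
  shows "col_entries lam T j = {}"
proof -
  have "(i, j) \<notin> diagram lam" for i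
    using is_partition_antimono[OF assms(1), of 1 i] assms(2) by (auto simp: diagram_def)
  then show ?thesis by (simp add: col_entries_def)
qed

text \<open>Empty rows and columns contribute 1. The slack in the bounds lets two shapes be compared
  along the same index lists, even if the corner is alone in its row or column.\<close>

lemma young_symmetrizer_eq:
  assumes "is_partition lam n" "col_len lam 1 \<le> N" "lam 1 \<le> M"
  shows "young_symmetrizer lam T = (row_prod lam T N * col_prod lam T M :: 'k::field_char_0 group_alg)"
proof -
  have rows: "(row_prod lam T N :: 'k group_alg) = row_prod lam T (col_len lam 1)"
    unfolding row_prod_def using assms(2)
    by (rule prod_list_map_upt_extend) (simp add: row_entries_empty[OF assms(1)])
  have cols: "(col_prod lam T M :: 'k group_alg) = col_prod lam T (lam 1)"
    unfolding col_prod_def using assms(3)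
    by (rule prod_list_map_upt_extend) (simp add: col_entries_empty[OF assms(1)])
  show ?thesis
    unfolding rows cols by (simp only: young_symmetrizer_def row_prod_def col_prod_def)
qed

lemma tr_mult_young_symmetrizer:
  assumes lam: "is_partition lam n" and inj: "inj_on T (diagram lam)"
    and ij: "(i, j) \<in> diagram lam" "(i, j') \<in> diagram lam"
  shows "tr (T (i, j)) (T (i, j')) * young_symmetrizer lam T = young_symmetrizer lam T"
proof -
  let ?f = "\<lambda>i. symmetrizer (row_entries lam T i) :: 'a group_alg"
  let ?t = "tr (T (i, j)) (T (i, j'))"
  have mem: "T (i, j) \<in> row_entries lam T i" "T (i, j') \<in> row_entries lam T i"
    using ij by (auto simp: row_entries_def)
  have "?t * row_prod lam T (col_len lam 1) = prod_list (map (?f(i := ?t * ?f i)) [1..<Suc (col_len lam 1)])"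
    unfolding row_prod_def
  proof (rule prod_list_update_left[symmetric])
    show "i \<in> set [1..<Suc (col_len lam 1)]"
      using ij(1) diagram_col_iff[OF lam, of i 1] by (auto simp: diagram_def)
    fix i' assume "i' \<noteq> i"
    then show "commutes ?t (?f i')"
      using row_entries_disjoint[OF inj, of i i'] mem by (intro commutes_tr_symmetrizer) auto
  qed simp
  also have "?t * ?f i = ?f i" using mem by (rule tr_mult_symmetrizer)
  also have "prod_list (map (?f(i := ?f i)) [1..<Suc (col_len lam 1)]) = row_prod lam T (col_len lam 1)"
    unfolding row_prod_def by (intro arg_cong[where f=prod_list] map_cong) auto
  finally show ?thesis
    unfolding young_symmetrizer_eq[OF lam order_refl order_refl] by (simp flip: mult.assoc)
qed

lemma row_prod_mult_tr:
  assumes lam: "is_partition lam n" and inj: "inj_on T (diagram lam)"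
    and ij: "(i, j) \<in> diagram lam" "(i, j') \<in> diagram lam"
  shows "row_prod lam T (col_len lam 1) * tr (T (i, j)) (T (i, j')) = row_prod lam T (col_len lam 1)"
proof -
  let ?f = "\<lambda>i. symmetrizer (row_entries lam T i) :: 'a group_alg"
  let ?t = "tr (T (i, j)) (T (i, j'))"
  have mem: "T (i, j) \<in> row_entries lam T i" "T (i, j') \<in> row_entries lam T i"
    using ij by (auto simp: row_entries_def)
  have "row_prod lam T (col_len lam 1) * ?t = prod_list (map (?f(i := ?f i * ?t)) [1..<Suc (col_len lam 1)])"
    unfolding row_prod_def
  proof (rule prod_list_update_right[symmetric])
    show "i \<in> set [1..<Suc (col_len lam 1)]"
      using ij(1) diagram_col_iff[OF lam, of i 1] by (auto simp: diagram_def)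
    fix i' assume "i' \<noteq> i"
    then show "commutes ?t (?f i')"
      using row_entries_disjoint[OF inj, of i i'] mem by (intro commutes_tr_symmetrizer) auto
  qed simp
  also have "?f i * ?t = ?f i" using mem by (rule symmetrizer_mult_tr)
  also have "prod_list (map (?f(i := ?f i)) [1..<Suc (col_len lam 1)]) = row_prod lam T (col_len lam 1)"
    unfolding row_prod_def by (intro arg_cong[where f=prod_list] map_cong) auto
  finally show ?thesis .
qed

text \<open>Each factor 1 - 1/g(c) equals g(c - 1)/g(c).\<close>

lemma prod_telescope:
  fixes g :: "nat \<Rightarrow> 'k::field"
  assumes "p \<le> q" "\<And>c. p \<le> c \<Longrightarrow> c < q \<Longrightarrow> g (Suc c) = g c + 1"
    "\<And>c. p \<le> c \<Longrightarrow> c \<le> q \<Longrightarrow> g c \<noteq> 0"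
  shows "(\<Prod>c\<in>{p<..q}. 1 - 1 / g c) = g p / g q"
  using assms
proof (induction q rule: dec_induct)
  case (step q)
  have nz: "g (Suc q) \<noteq> 0" "g q \<noteq> 0" using step.prems(2)[of q] step.prems(2)[of "Suc q"] step.hyps by auto
  have "g (Suc q) = g q + 1" using step.prems(1) step.hyps by auto
  then have g: "g q = g (Suc q) - 1" by simp
  have "{p<..Suc q} = insert (Suc q) {p<..q}" using step.hyps by auto
  then have "(\<Prod>c\<in>{p<..Suc q}. 1 - 1 / g c) = (1 - 1 / g (Suc q)) * (\<Prod>c\<in>{p<..q}. 1 - 1 / g c)"
    by simp
  also have "(\<Prod>c\<in>{p<..q}. 1 - 1 / g c) = g p / g q"
    by (rule step.IH) (use step.prems in auto)
  also have "1 - 1 / g (Suc q) = g q / g (Suc q)"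
    using nz by (simp add: g divide_simps)
  finally show ?case using nz by simp
qed simp

text \<open>The same function \<open>T\<close> serves both shapes, since entries are only read
  inside a diagram; a subtableau is thus just a change of shape.\<close>

locale young_corner =
  fixes lam mu :: "nat \<Rightarrow> nat" and n k u v :: nat and T :: tableau
  assumes lam: "is_partition lam n" and mu: "is_partition mu k"
    and diag: "diagram lam = insert (u, v) (diagram mu)" and new: "(u, v) \<notin> diagram mu"
    and inj: "inj_on T (diagram lam)"
begin

abbreviation a where "a \<equiv> T (u, v)"
abbreviation C where "C \<equiv> col_entries lam T"

lemma uv: "1 \<le> u" "1 \<le> v" "v \<le> lam u"
  using diag by (auto simp: diagram_def)

lemma mu_other: "i \<noteq> u \<Longrightarrow> mu i = lam i"
proof (cases "i = 0")
  case True
  then show ?thesis using lam mu by (simp add: is_partition_def)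
next
  case False
  assume "i \<noteq> u"
  then have "(i, j) \<in> diagram lam \<longleftrightarrow> (i, j) \<in> diagram mu" for j using diag by auto
  then have "1 \<le> j \<Longrightarrow> j \<le> lam i \<longleftrightarrow> j \<le> mu i" for j using False by (auto simp: diagram_def)
  from this[of "mu i"] this[of "lam i"] show ?thesis by (cases "lam i"; cases "mu i") auto
qed

lemma lam_u: "lam u = v" and mu_u: "mu u = v - 1"
proof -
  have *: "1 \<le> j \<Longrightarrow> j \<le> lam u \<longleftrightarrow> j = v \<or> j \<le> mu u" for j
  proof -
    have "(u, j) \<in> diagram lam \<longleftrightarrow> (u, j) = (u, v) \<or> (u, j) \<in> diagram mu" using diag by auto
    then show "1 \<le> j \<Longrightarrow> j \<le> lam u \<longleftrightarrow> j = v \<or> j \<le> mu u"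
      using uv by (auto simp: diagram_def)
  qed
  have "mu u < v" using new uv by (auto simp: diagram_def)
  then show "lam u = v" using *[of "lam u"] uv by auto
  show "mu u = v - 1"
  proof (cases "v = 1")
    case False
    then have "1 \<le> v - 1" using uv by linarith
    from *[OF this] have "v - 1 \<le> mu u" using uv by linarith
    then show ?thesis using \<open>mu u < v\<close> by auto
  qed (use \<open>mu u < v\<close> in auto)
qed

lemma diag_sub: "diagram mu \<subseteq> diagram lam"
  using diag by auto

lemma inj_mu: "inj_on T (diagram mu)"
  using inj diag_sub by (rule inj_on_subset)

lemma row_u_entries: "row_entries lam T u = insert a (row_entries mu T u)"
  and row_other_entries: "i \<noteq> u \<Longrightarrow> row_entries lam T i = row_entries mu T i"
  by (auto simp: row_entries_def diag)

lemma col_v_entries: "C v = insert a (col_entries mu T v)"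
  and col_other_entries: "j \<noteq> v \<Longrightarrow> C j = col_entries mu T j"
  by (auto simp: col_entries_def diag)

lemma a_notin: "a \<notin> T ` diagram mu"
  using inj new diag by (auto simp: inj_on_def)

lemma a_notin_entries: "a \<notin> row_entries mu T i" "a \<notin> col_entries mu T j"
  using a_notin by (auto simp: row_entries_def col_entries_def)

lemma finite_entries: "finite (row_entries mu T i)" "finite (col_entries mu T j)" "finite (C j)"
  using finite_diagram[OF lam] finite_diagram[OF mu] by (auto simp: row_entries_eq col_entries_eq)

lemma col_mu: "col_entries mu T = C(v := C v - {a})"
  using col_v_entries col_other_entries a_notin_entries by (auto simp: fun_eq_iff)

lemma col_len_v: "col_len lam v = u"
proof -
  have "v \<le> lam i \<longleftrightarrow> i \<le> u" if "1 \<le> i" for i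
  proof
    assume "i \<le> u"
    then show "v \<le> lam i" using is_partition_antimono[OF lam that, of u] lam_u by simp
  next
    assume v: "v \<le> lam i"
    show "i \<le> u"
    proof (rule ccontr)
      assume "\<not> i \<le> u"
      then have "mu i \<le> mu u" using is_partition_antimono[OF mu, of u i] uv by auto
      then show False using v mu_other[of i] mu_u \<open>\<not> i \<le> u\<close> uv by auto
    qed
  qed
  then have "{i. (i, v) \<in> diagram lam} = {1..u}" using uv by (auto simp: diagram_def)
  then show ?thesis by (simp add: col_len_def)
qed

lemma col_len_gt:
  assumes "v < c" shows "col_len lam c < u"
proof -
  have "(u, c) \<notin> diagram lam" using lam_u assms by (auto simp: diagram_def)
  then show ?thesis using diagram_col_iff[OF lam, of u c] uv assms by auto
qed

lemma row_less:
  assumes "(i, c) \<in> diagram lam" "v < c"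
  shows "i < u"
  using diagram_col_iff[OF lam, of i c] assms col_len_gt[of c] by auto

sublocale column_corner C v a
proof
  show "card (C c) < card (C v)" if "v < c" for c
    using col_len_gt[OF that] col_len_v by (simp add: card_col_entries[OF inj])
qed (use finite_entries col_entries_disjoint[OF inj] col_v_entries uv in auto)

lemma corner_weight_eq: "corner_weight C v c = of_nat (c - v + u) - of_nat (col_len lam c)"
  by (simp add: corner_weight_def card_col_entries[OF inj] col_len_v)

text \<open>The new row factor involves only row u and commutes with the symmetrizers of the other,
  disjoint rows, so it moves to the far left; likewise the column factor moves to the far
  right.\<close>

lemma young_symmetrizer_corner:
  "young_symmetrizer lam T =
    (1 + trsum (row_entries mu T u) a) * young_symmetrizer mu T * (1 - trsum (C v - {a}) a)"
proof -
  define N where "N = max (max u (col_len lam 1)) (col_len mu 1)"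
  define M where "M = max (max v (lam 1)) (mu 1)"
  let ?g = "1 + trsum (row_entries mu T u) a :: 'a group_alg"
  let ?f = "\<lambda>i. symmetrizer (row_entries mu T i) :: 'a group_alg"
  let ?h = "1 - trsum (C v - {a}) a :: 'a group_alg"
  let ?e = "\<lambda>i. antisymmetrizer (col_entries mu T i) :: 'a group_alg"
  have Cv: "C v - {a} = col_entries mu T v" using col_mu by simp
  have "(\<lambda>i. symmetrizer (row_entries lam T i)) = ?f(u := ?g * ?f u)"
    using symmetrizer_insert[OF finite_entries(1) a_notin_entries(1), of u]
    by (auto simp: fun_eq_iff row_u_entries row_other_entries)
  then have "row_prod lam T N = prod_list (map (?f(u := ?g * ?f u)) [1..<Suc N])"
    by (simp add: row_prod_def)
  also have "\<dots> = ?g * row_prod mu T N"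
    unfolding row_prod_def
  proof (rule prod_list_update_left)
    show "u \<in> set [1..<Suc N]" using uv by (auto simp: N_def)
    fix i assume "i \<noteq> u"
    then have "x \<notin> row_entries mu T i" if "x \<in> row_entries mu T u" for x
      using row_entries_disjoint[OF inj_mu, of i u] that by auto
    then have "commutes (?f i) ?g"
      unfolding trsum_def using a_notin_entries
      by (intro commutes_add commutes_one commutes_sum commutes_sym[OF commutes_tr_symmetrizer]) auto
    then show "commutes ?g (?f i)" by (rule commutes_sym)
  qed simp
  finally have rows: "row_prod lam T N = ?g * row_prod mu T N" .
  have "(\<lambda>i. antisymmetrizer (col_entries lam T i)) = ?e(v := ?e v * ?h)"
    unfolding Cv using antisymmetrizer_insert[OF finite_entries(2) a_notin_entries(2), of v]
    by (auto simp: fun_eq_iff col_v_entries col_other_entries)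
  then have "col_prod lam T M = prod_list (map (?e(v := ?e v * ?h)) [1..<Suc M])"
    by (simp add: col_prod_def)
  also have "\<dots> = col_prod mu T M * ?h"
    unfolding col_prod_def
  proof (rule prod_list_update_right)
    show "v \<in> set [1..<Suc M]" using uv by (auto simp: M_def)
    fix j assume "j \<noteq> v"
    then have "x \<notin> col_entries mu T j" if "x \<in> col_entries mu T v" for x
      using col_entries_disjoint[OF inj_mu, of j v] that by auto
    then have "commutes (?e j) ?h"
      unfolding trsum_def Cv using a_notin_entries
      by (intro commutes_diff commutes_one commutes_sum commutes_sym[OF commutes_tr_antisymmetrizer]) auto
    then show "commutes ?h (?e j)" by (rule commutes_sym)
  qed simp
  finally have cols: "col_prod lam T M = col_prod mu T M * ?h" .
  have "(young_symmetrizer lam T :: 'a group_alg) = row_prod lam T N * col_prod lam T M"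
    by (rule young_symmetrizer_eq[OF lam]) (auto simp: N_def M_def)
  moreover have "(young_symmetrizer mu T :: 'a group_alg) = row_prod mu T N * col_prod mu T M"
    by (rule young_symmetrizer_eq[OF mu]) (auto simp: N_def M_def)
  ultimately show ?thesis by (simp add: rows cols mult.assoc)
qed

text \<open>Rows above u have length at least v, so each of their entries has a row mate in column v
  other than \<open>a\<close>. This supplies the d of \<open>alternates_row_vanish\<close>.\<close>

lemma row_partner:
  assumes "(i, j) \<in> diagram mu" "i < u"
  shows "T (i, v) \<in> C v - {a}"
    "tr (T (i, j)) (T (i, v)) * young_symmetrizer mu T = young_symmetrizer mu T"
proof -
  have i: "1 \<le> i" using assms by (auto simp: diagram_def)
  then have "v \<le> mu i"
    using is_partition_antimono[OF lam i, of u] assms lam_u mu_other[of i] by auto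
  then have iv: "(i, v) \<in> diagram mu" using i uv by (auto simp: diagram_def)
  then have "T (i, v) \<in> col_entries mu T v" by (auto simp: col_entries_def)
  then show "T (i, v) \<in> C v - {a}" by (simp add: col_mu)
  show "tr (T (i, j)) (T (i, v)) * young_symmetrizer mu T = young_symmetrizer mu T"
    using assms iv by (intro tr_mult_young_symmetrizer[OF mu inj_mu])
qed

lemma corner_prod_absorb:
  assumes w: "specht_rel w C"
  shows "w * corner_prod C v N a * young_symmetrizer mu T = w * young_symmetrizer mu T"
  unfolding corner_prod_def
proof (rule alternates_factors_absorb)
  show "alternates w (insert a (C v - {a}))"
    unfolding insert_D using w uv by (simp add: specht_rel_def)
  fix c b assume c: "c \<in> set [Suc v..<Suc N]" and b: "b \<in> C c"
  then have "v < c" by auto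
  from b obtain i where "b = T (i, c)" and ic: "(i, c) \<in> diagram lam"
    by (auto simp: col_entries_def)
  then have i: "b = T (i, c)" "(i, c) \<in> diagram mu" "i < u"
    using diag row_less[OF ic \<open>v < c\<close>] \<open>v < c\<close> by auto
  have "b \<notin> insert a (C v - {a})"
    unfolding insert_D using notin_other[OF b, of v] \<open>v < c\<close> by auto
  then show "b \<notin> insert a (C v - {a}) \<and> (\<exists>d\<in>C v - {a}. tr b d * young_symmetrizer mu T = young_symmetrizer mu T)"
    using row_partner[OF i(2,3)] i(1) by auto
qed (use col_entries_disjoint[OF inj] in auto)

text \<open>For j < v the exchange relation writes w as the sum of w (x a) over x in column j. In
  front of the symmetrizer of \<open>mu\<close> all x above row u die, leaving only x = T(u, j).
  Each of these v - 1 entries thus acts as 1, and the identity adds one more. The result v is the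
  quotient of v! by (v - 1)!, the products of hooks in the last row.\<close>

lemma last_row_absorb:
  assumes w: "specht_rel w C" and last: "mu (Suc u) = 0"
  shows "w * (1 + trsum (row_entries mu T u) a) * young_symmetrizer mu T =
    of_nat v * (w * young_symmetrizer mu T)"
proof -
  let ?Y = "young_symmetrizer mu T"
  have last': "i \<le> u" if "(i, j) \<in> diagram mu" for i j
  proof (rule ccontr)
    assume "\<not> i \<le> u"
    then have "mu i \<le> mu (Suc u)" using is_partition_antimono[OF mu, of "Suc u" i] by auto
    then show False using that last by (auto simp: diagram_def)
  qed
  have R: "row_entries mu T u = (\<lambda>j. T (u, j)) ` {1..<v}"
  proof -
    have "{j. (u, j) \<in> diagram mu} = {1..<v}" using uv mu_u by (auto simp: diagram_def)
    moreover have "row_entries mu T u = (\<lambda>j. T (u, j)) ` {j. (u, j) \<in> diagram mu}"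
      by (auto simp: row_entries_def)
    ultimately show ?thesis by simp
  qed
  have "w * tr (T (u, j)) a * ?Y = w * ?Y" if j: "j \<in> {1..<v}" for j
  proof -
    have uj: "(u, j) \<in> diagram mu" using j mu_u uv by (auto simp: diagram_def)
    have Tuj: "T (u, j) \<in> C j" using uj diag_sub by (auto simp: col_entries_def)
    have "garnir w (C j) (C v)"
      using w j col_entries_disjoint[OF inj] by (intro specht_rel_garnir) auto
    then have "w * ?Y = w * trsum (C j) a * ?Y"
      using a by (simp add: garnirD)
    also have "\<dots> = w * tr (T (u, j)) a * ?Y + (\<Sum>x\<in>C j - {T (u, j)}. w * tr x a * ?Y)"
      unfolding mult_trsum_mult using fin Tuj by (rule sum.remove)
    also have "(\<Sum>x\<in>C j - {T (u, j)}. w * tr x a * ?Y) = 0"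
    proof (rule sum.neutral, rule ballI)
      fix x assume x: "x \<in> C j - {T (u, j)}"
      then obtain i where i: "x = T (i, j)" "(i, j) \<in> diagram mu" "i \<noteq> u"
        using col_other_entries[of j] j by (auto simp: col_entries_def)
      then have "i < u" using last'[OF i(2)] by auto
      note p = row_partner[OF i(2) this]
      have "w * tr x a * 1 * ?Y = 0"
      proof (rule alternates_row_vanish)
        show "alternates w (insert a (C v - {a}))"
          unfolding insert_D using w uv by (simp add: specht_rel_def)
        show "x \<notin> insert a (C v - {a})"
          unfolding insert_D using notin_other[of x j v] x j by auto
      qed (use p i in auto)
      then show "w * tr x a * ?Y = 0" by simp
    qed
    finally show ?thesis by simp
  qed
  then have *: "(\<Sum>x\<in>row_entries mu T u. w * tr x a * ?Y) = (\<Sum>x\<in>row_entries mu T u. w * ?Y)"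
    by (intro sum.cong) (auto simp: R)
  have "inj_on (\<lambda>j. T (u, j)) {1..<v}"
  proof (rule inj_onI)
    fix x y assume xy: "x \<in> {1..<v}" "y \<in> {1..<v}" "T (u, x) = T (u, y)"
    then have "(u, x) \<in> diagram mu" "(u, y) \<in> diagram mu"
      using mu_u uv by (auto simp: diagram_def)
    with inj_onD[OF inj_mu xy(3)] show "x = y" by auto
  qed
  then have card: "card (row_entries mu T u) = v - 1"
    unfolding R by (simp add: card_image)
  have "w * trsum (row_entries mu T u) a * ?Y = of_nat (v - 1) * (w * ?Y)"
    unfolding mult_trsum_mult * by (simp add: card)
  moreover have "of_nat v = (of_nat (v - 1) + 1 :: 'a group_alg)"
    using uv by (simp add: of_nat_diff)
  ultimately show ?thesis by (simp add: distrib_left distrib_right)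
qed

section \<open>Hook lengths with and without the corner\<close>

lemma col_len_mu: "col_len mu j = col_len lam j - (if j = v then 1 else 0)"
proof -
  have "col_len mu j = card (col_entries mu T j)"
    by (simp add: card_col_entries[OF inj_mu])
  also have "\<dots> = card (C j) - (if j = v then 1 else 0)"
    using a fin by (auto simp: col_mu)
  finally show ?thesis by (simp add: card_col_entries[OF inj])
qed

text \<open>Induction upwards through the diagram from row u. Going from row i + 1 to row i adds the
  columns of length exactly i; their weights c - v + (u - i) are consecutive and telescope. The
  right-hand side collects the quotients of the hook lengths at (j, v) with and without the
  corner.\<close>

lemma arm_leg_telescope:
  assumes "1 \<le> i" "i \<le> u"
  shows "of_nat (lam i - v + (u - i) + 1) * (\<Prod>c\<in>{v<..lam i}. 1 - 1 / corner_weight C v c) =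
    (\<Prod>j\<in>{i..<u}. of_nat (lam j - v + (u - j) + 1) / of_nat (lam j - v + (u - j)) :: 'k::field_char_0)"
  using \<open>i \<le> u\<close> \<open>1 \<le> i\<close>
proof (induction i rule: inc_induct)
  case base
  then show ?case by (simp add: lam_u)
next
  case (step i)
  let ?g = "\<lambda>c. of_nat (c - v + (u - i)) :: 'k"
  let ?P = "\<lambda>i. \<Prod>c\<in>{v<..lam i}. 1 - 1 / corner_weight C v c :: 'k"
  have i: "1 \<le> i" using step.prems by simp
  have le: "v \<le> lam (Suc i)" "lam (Suc i) \<le> lam i"
    using is_partition_antimono[OF lam, of "Suc i" u] is_partition_antimono[OF lam i, of "Suc i"]
      lam_u step.hyps by auto
  have "{v<..lam i} = {v<..lam (Suc i)} \<union> {lam (Suc i)<..lam i}"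
    using le by auto
  then have "?P i = ?P (Suc i) * (\<Prod>c\<in>{lam (Suc i)<..lam i}. 1 - 1 / corner_weight C v c)"
    by (simp only:) (intro prod.union_disjoint, auto)
  also have "(\<Prod>c\<in>{lam (Suc i)<..lam i}. 1 - 1 / corner_weight C v c) = (\<Prod>c\<in>{lam (Suc i)<..lam i}. 1 - 1 / ?g c)"
  proof (rule prod.cong[OF refl])
    fix c assume c: "c \<in> {lam (Suc i)<..lam i}"
    then have "(i, c) \<in> diagram lam" "(Suc i, c) \<notin> diagram lam"
      using i by (auto simp: diagram_def)
    then have "col_len lam c = i"
      using diagram_col_iff[OF lam, of i c] diagram_col_iff[OF lam, of "Suc i" c] by auto
    then have "corner_weight C v c = ?g c"
      using step.hyps by (simp add: corner_weight_eq of_nat_diff)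
    then show "1 - 1 / corner_weight C v c = 1 - 1 / ?g c" by simp
  qed
  also have "\<dots> = ?g (lam (Suc i)) / ?g (lam i)"
  proof (rule prod_telescope)
    show "?g c \<noteq> 0" for c
      unfolding of_nat_eq_0_iff using step.hyps by simp
  qed (use le in \<open>auto simp: Suc_diff_le\<close>)
  finally have P: "?P i = ?P (Suc i) * (?g (lam (Suc i)) / ?g (lam i))" .
  have "?g (lam (Suc i)) * ?P (Suc i) =
      (\<Prod>j\<in>{Suc i..<u}. of_nat (lam j - v + (u - j) + 1) / of_nat (lam j - v + (u - j)))"
    using step.IH step.hyps by (simp add: Suc_diff_Suc)
  moreover have "{i..<u} = insert i {Suc i..<u}" using step.hyps by auto
  ultimately show ?case
    unfolding P by (simp add: field_simps)
qed

text \<open>Only hooks in row u and column v change, each by one, and the corner itself has hook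
  length 1. The row quotients telescope to v; the column quotients are
  \<open>arm_leg_telescope\<close> from the first row.\<close>

lemma hook_product_corner:
  assumes last: "mu (Suc u) = 0"
  shows "of_nat (hook_product lam) = (of_nat (hook_product mu) * (of_nat v * (of_nat (lam 1 - v + u) *
    (\<Prod>c\<in>{v<..lam 1}. 1 - 1 / corner_weight C v c))) :: 'k::field_char_0)"
proof -
  let ?h = "\<lambda>p. of_nat (card (hook mu (fst p) (snd p))) :: 'k"
  let ?h' = "\<lambda>p. of_nat (card (hook lam (fst p) (snd p))) :: 'k"
  let ?row = "(\<lambda>j. (u, j)) ` {1..<v}" and ?col = "(\<lambda>i. (i, v)) ` {1..<u}"
  have prods: "of_nat (hook_product lam) = (\<Prod>p\<in>diagram lam. ?h' p)"
    "of_nat (hook_product mu) = (\<Prod>p\<in>diagram mu. ?h p)"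
    by (simp_all add: hook_product_def case_prod_beta)
  have nz: "?h p \<noteq> 0" if "p \<in> diagram mu" for p
    using card_hook[OF mu, of "fst p" "snd p"] that by (auto simp del: of_nat_Suc)
  have col_lam: "col_len lam j = col_len mu j + (if j = v then 1 else 0)" for j
    using col_len_mu[of j] col_len_v uv by auto
  have h': "?h' (x, y) = ?h (x, y) + (if x = u \<or> y = v then 1 else 0)" if p: "(x, y) \<in> diagram mu" for x y
  proof -
    have xy: "y \<le> mu x" "x \<le> col_len mu y" "(x, y) \<noteq> (u, v)" "(x, y) \<in> diagram lam"
      using p new diag_sub diagram_col_iff[OF mu, of x y] by (auto simp: diagram_def)
    have "lam x = mu x + (if x = u then 1 else 0)"
      using mu_other[of x] lam_u mu_u uv by auto
    then show ?thesis
      using xy by (auto simp: card_hook[OF mu p] card_hook[OF lam xy(4)] col_lam Suc_diff_le)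
  qed
  have corner: "?h' (u, v) = 1"
    using card_hook[OF lam, of u v] diag lam_u col_len_v by simp
  have sub: "?row \<subseteq> diagram mu" "?col \<subseteq> diagram mu"
  proof -
    show "?row \<subseteq> diagram mu" using mu_u uv by (auto simp: diagram_def)
    have "(i, v) \<in> diagram lam" if "1 \<le> i" "i < u" for i
      using that diagram_col_iff[OF lam, of i v] uv col_len_v by auto
    then show "?col \<subseteq> diagram mu" using diag by auto
  qed
  have "(\<Prod>p\<in>diagram lam. ?h' p) = (\<Prod>p\<in>diagram mu. ?h' p)"
    unfolding diag using new finite_diagram[OF mu] corner by simp
  also have "\<dots> = (\<Prod>p\<in>diagram mu. ?h p * (?h' p / ?h p))"
    using nz by (intro prod.cong refl) simp
  also have "\<dots> = (\<Prod>p\<in>diagram mu. ?h p) * (\<Prod>p\<in>diagram mu. ?h' p / ?h p)"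
    by (rule prod.distrib)
  also have "(\<Prod>p\<in>diagram mu. ?h' p / ?h p) = (\<Prod>p\<in>?row \<union> ?col. ?h' p / ?h p)"
  proof (rule prod.mono_neutral_right)
    show "\<forall>p\<in>diagram mu - (?row \<union> ?col). ?h' p / ?h p = 1"
    proof
      fix p assume p: "p \<in> diagram mu - (?row \<union> ?col)"
      obtain x y where xy: "p = (x, y)" by (cases p)
      have mem: "(x, y) \<in> diagram mu" using p xy by simp
      have "x \<noteq> u" using p xy mem mu_u uv by (auto simp: diagram_def)
      moreover have "y \<noteq> v"
        using p xy mem diagram_col_iff[OF mu, of x y] col_len_mu[of v] col_len_v by auto
      ultimately show "?h' p / ?h p = 1"
        using h'[OF mem] nz[OF mem] xy by simp
    qed
  qed (use finite_diagram[OF mu] sub in auto)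
  also have "\<dots> = (\<Prod>p\<in>?row. ?h' p / ?h p) * (\<Prod>p\<in>?col. ?h' p / ?h p)"
    by (rule prod.union_disjoint) auto
  also have "(\<Prod>p\<in>?row. ?h' p / ?h p) = (\<Prod>j\<in>{1..<v}. of_nat (v - j + 1) / of_nat (v - j))"
  proof (subst prod.reindex, simp add: inj_on_def, rule prod.cong[OF refl])
    fix j assume j: "j \<in> {1..<v}"
    then have mem: "(u, j) \<in> diagram mu" using sub by auto
    \<comment> \<open>As row u is the last one, the hooks in it have no leg.\<close>
    have "(Suc u, j) \<notin> diagram mu" using last by (auto simp: diagram_def)
    then have "col_len mu j = u"
      using mem diagram_col_iff[OF mu, of "Suc u" j] diagram_col_iff[OF mu, of u j] by auto
    then have "card (hook mu u j) = v - j"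
      using j mu_u by (simp add: card_hook[OF mu mem] Suc_diff_Suc)
    then show "((\<lambda>p. ?h' p / ?h p) \<circ> (\<lambda>j. (u, j))) j = of_nat (v - j + 1) / of_nat (v - j)"
      using h'[OF mem] by simp
  qed
  also have "\<dots> = of_nat v"
  proof -
    have "(\<Prod>j\<in>{i..<v}. of_nat (v - j + 1) / of_nat (v - j) :: 'k) = of_nat (v - i + 1)"
      if "i \<le> v" for i
      using that
    proof (induction i rule: inc_induct)
      case (step i)
      then have "{i..<v} = insert i {Suc i..<v}" "v - Suc i + 1 = v - i" "v - i \<noteq> 0" by auto
      with step.IH show ?case by simp
    qed simp
    from this[of 1] show ?thesis using uv by simp
  qed
  also have "(\<Prod>p\<in>?col. ?h' p / ?h p) =
      (\<Prod>i\<in>{1..<u}. of_nat (lam i - v + (u - i) + 1) / of_nat (lam i - v + (u - i)))"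
  proof (subst prod.reindex, simp add: inj_on_def, rule prod.cong[OF refl])
    fix i assume i: "i \<in> {1..<u}"
    then have mem: "(i, v) \<in> diagram mu" using sub by auto
    have "card (hook mu i v) = lam i - v + (u - i)"
      using i mu_other[of i] by (simp add: card_hook[OF mu mem] col_len_mu col_len_v) arith
    then show "((\<lambda>p. ?h' p / ?h p) \<circ> (\<lambda>i. (i, v))) i =
        of_nat (lam i - v + (u - i) + 1) / of_nat (lam i - v + (u - i))"
      using h'[OF mem] by (simp add: algebra_simps)
  qed
  also have "\<dots> = of_nat (lam 1 - v + (u - 1) + 1) * (\<Prod>c\<in>{v<..lam 1}. 1 - 1 / corner_weight C v c)"
    using uv by (intro arm_leg_telescope[symmetric]) auto
  also have "lam 1 - v + (u - 1) + 1 = lam 1 - v + u"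
    using uv by simp
  finally show ?thesis
    by (simp only: prods)
qed

end

section \<open>Induction over corners in the last row\<close>

lemma exists_last_corner:
  assumes lam: "is_partition lam (Suc k)" and inj: "inj_on T (diagram lam)"
  obtains mu u v where "young_corner lam mu (Suc k) k u v T" "mu (Suc u) = 0"
proof -
  let ?u = "Max {i. lam i \<noteq> 0}"
  let ?mu = "lam(?u := lam ?u - 1)"
  have fin: "finite {i. lam i \<noteq> 0}" and sum: "(\<Sum>i\<in>{i. lam i \<noteq> 0}. lam i) = Suc k"
    using lam by (auto simp: is_partition_def)
  have "{i. lam i \<noteq> 0} \<noteq> {}" using sum by (metis sum.empty nat.distinct(1))
  then have u: "lam ?u \<noteq> 0" using Max_in[OF fin] by auto
  have above: "lam i = 0" if "?u < i" for i
    using Max_ge[OF fin, of i] that by (cases "lam i = 0") auto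
  have u1: "1 \<le> ?u" using u lam by (cases "?u = 0") (auto simp: is_partition_def)
  have "is_partition ?mu k"
    unfolding is_partition_def
  proof (intro conjI allI impI)
    show "?mu 0 = 0" using lam u1 by (auto simp: is_partition_def)
    show "?mu (Suc i) \<le> ?mu i" if "1 \<le> i" for i
      using is_partition_antimono[OF lam that, of "Suc i"] above[of "Suc i"] by auto
    show "finite {i. ?mu i \<noteq> 0}"
      by (rule finite_subset[OF _ fin]) auto
    have "(\<Sum>i\<in>{i. ?mu i \<noteq> 0}. ?mu i) = (\<Sum>i\<in>{i. lam i \<noteq> 0}. ?mu i)"
      by (rule sum.mono_neutral_left) (use fin in auto)
    also have "\<dots> = (lam ?u - 1) + (\<Sum>i\<in>{i. lam i \<noteq> 0} - {?u}. lam i)"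
      using fin u by (subst sum.remove[of _ ?u]) auto
    also have "\<dots> = k"
      using sum sum.remove[OF fin, of ?u lam] u by auto
    finally show "(\<Sum>i\<in>{i. ?mu i \<noteq> 0}. ?mu i) = k" .
  qed
  moreover have "diagram lam = insert (?u, lam ?u) (diagram ?mu)"
    using u u1 by (auto simp: diagram_def split: if_splits)
  moreover have "(?u, lam ?u) \<notin> diagram ?mu"
    using u by (auto simp: diagram_def)
  ultimately have "young_corner lam ?mu (Suc k) k ?u (lam ?u) T"
    using lam inj by unfold_locales auto
  moreover have "?mu (Suc ?u) = 0" using above[of "Suc ?u"] by simp
  ultimately show ?thesis by (rule that)
qed

text \<open>
  For \<open>w = young_symmetrizer lam T\<close> this is the quasi-idempotence of Young symmetrizers together
  with the hook length formula. The last row is chosen for the removed corner \<open>a\<close> because then all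
  other entries of a column to the left of \<open>a\<close> lie above the row of \<open>a\<close>, where they contribute 0.
\<close>

lemma specht_rel_mult_young_symmetrizer:
  assumes "is_partition lam n" "inj_on T (diagram lam)" "specht_rel w (col_entries lam T)"
  shows "w * young_symmetrizer lam T = of_nat (hook_product lam) * w"
  using assms
proof (induction n arbitrary: lam w)
  case 0
  then have lam: "lam i = 0" for i
    by (cases "lam i = 0") (auto simp: is_partition_def)
  then have "diagram lam = {}" by (auto simp: diagram_def)
  then have "col_len lam 1 = 0" "hook_product lam = 1"
    by (simp_all add: col_len_def hook_product_def)
  moreover have "young_symmetrizer lam T = (1 :: 'a group_alg)"
    unfolding young_symmetrizer_def \<open>col_len lam 1 = 0\<close> lam[of 1] by simp
  ultimately show ?case by simp
next
  case (Suc k)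
  obtain mu u v where "young_corner lam mu (Suc k) k u v T" and last: "mu (Suc u) = 0"
    using exists_last_corner[OF Suc.prems(1,2)] by blast
  then interpret young_corner lam mu "Suc k" k u v T by simp
  let ?W = "corner_prod C v (lam 1) a :: 'a group_alg"
  let ?Y = "young_symmetrizer mu T :: 'a group_alg"
  let ?\<kappa> = "of_nat (lam 1 - v + u) * (\<Prod>c\<in>{v<..lam 1}. 1 - 1 / corner_weight C v c) :: 'a"
  note w = \<open>specht_rel w C\<close>
  have vN: "v \<le> lam 1"
    using is_partition_antimono[OF lam, of 1 u] uv lam_u by simp
  have "specht_rel (w * ?W) (col_entries mu T)"
    unfolding col_mu using w col_entries_empty[OF lam] by (rule corner_prod_relations)
  \<comment> \<open>The hypothesis is applied to a different vector, \<open>w * ?W\<close>; this is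
    why \<open>w\<close> is generalized.\<close>
  then have IH: "w * ?W * ?Y = of_nat (hook_product mu) * (w * ?W)"
    by (rule Suc.IH[OF mu inj_mu])
  have "w * young_symmetrizer lam T =
      w * (1 + trsum (row_entries mu T u) a) * ?Y * (1 - trsum (C v - {a}) a)"
    unfolding young_symmetrizer_corner by (simp only: mult.assoc)
  also have "\<dots> = of_nat v * (w * ?W * ?Y) * (1 - trsum (C v - {a}) a)"
    unfolding last_row_absorb[OF w last] corner_prod_absorb[OF w] ..
  also have "\<dots> = of_nat v * (of_nat (hook_product mu) * (w * ?W * (1 - trsum (C v - {a}) a)))"
    unfolding IH by (simp only: mult.assoc)
  also have "w * ?W * (1 - trsum (C v - {a}) a) = scal ?\<kappa> * w"
    unfolding corner_prod_alternate[OF w vN] card_col_entries[OF inj] col_len_v ..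
  also have "of_nat v * (of_nat (hook_product mu) * (scal ?\<kappa> * w)) =
      scal (of_nat v * (of_nat (hook_product mu) * ?\<kappa>)) * w"
    by (simp only: scal_mult scal_simps mult.assoc)
  also have "of_nat v * (of_nat (hook_product mu) * ?\<kappa>) = of_nat (hook_product lam)"
    unfolding hook_product_corner[OF last] by (simp only: mult.left_commute)
  finally show ?case by simp
qed

section \<open>The relations satisfied by a Young symmetrizer\<close>

text \<open>After division by the factorial, statements about antisymmetrizers become statements
  about \<open>trsum\<close>.\<close>

lemma alternates_antisymmetrizer:
  assumes "finite C" "alternates w C"
  shows "w * antisymmetrizer C = of_nat (fact (card C)) * w"
  using assms
proof (induction C)
  case (insert x C)
  have "alternates w C" using insert.prems by (rule alternates_subset) auto
  then have IH: "w * antisymmetrizer C = of_nat (fact (card C)) * w" by (rule insert.IH)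
  have "w * antisymmetrizer (insert x C) = of_nat (fact (card C)) * (w - w * trsum C x)"
    unfolding antisymmetrizer_insert[OF insert.hyps] mult.assoc[symmetric] IH
    by (simp add: right_diff_distrib mult.assoc)
  also have "w * trsum C x = - (of_nat (card C) * w)"
    using insert by (intro alternates_trsum) auto
  also have "of_nat (fact (card C)) * (w - - (of_nat (card C) * w)) = of_nat (fact (card (insert x C))) * w"
    using insert.hyps by (simp add: distrib_left distrib_right mult.assoc mult_of_nat_commute)
  finally show ?case .
qed simp

lemma young_symmetrizer_alternates:
  assumes lam: "is_partition lam n" and inj: "inj_on T (diagram lam)"
  shows "alternates (young_symmetrizer lam T :: 'k::field_char_0 group_alg) (col_entries lam T j)"
  unfolding alternates_def
proof (intro ballI impI)
  fix x y assume xy: "x \<in> col_entries lam T j" "y \<in> col_entries lam T j" "x \<noteq> y"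
  let ?f = "\<lambda>j. antisymmetrizer (col_entries lam T j) :: 'k group_alg"
  let ?js = "[1..<Suc (lam 1)]"
  have j: "j \<in> set ?js"
  proof -
    have "j \<noteq> 0" using xy by (auto simp: col_entries_def diagram_def)
    moreover have "j \<le> lam 1" using xy col_entries_empty[OF lam, of j T] by (cases "j \<le> lam 1") auto
    ultimately show ?thesis by (simp del: upt_Suc)
  qed
  have "col_prod lam T (lam 1) * tr x y = prod_list (map (?f(j := ?f j * tr x y)) ?js)"
    unfolding col_prod_def
  proof (rule prod_list_update_right[symmetric])
    fix j' assume "j' \<noteq> j"
    then show "commutes (tr x y) (?f j')"
      using xy col_entries_disjoint[OF inj, of j j'] by (intro commutes_tr_antisymmetrizer) auto
  qed (use j in auto)
  also have "?f j * tr x y = ?f j * - 1"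
    using antisymmetrizer_mult_tr[OF xy] by simp
  also have "prod_list (map (?f(j := ?f j * - 1)) ?js) = col_prod lam T (lam 1) * - 1"
    unfolding col_prod_def using j
    by (intro prod_list_update_right) (auto simp: commutes_def)
  finally show "young_symmetrizer lam T * tr x y = (- young_symmetrizer lam T :: 'k group_alg)"
    unfolding young_symmetrizer_eq[OF lam order_refl order_refl] by (simp add: mult.assoc)
qed

text \<open>
  Moving a column permutation past the antisymmetrizer of \<open>insert y (col_entries lam T j)\<close> only
  changes \<open>y\<close> within its column, and each \<open>y\<close> shares its row with an entry of column \<open>j\<close>.
\<close>

lemma row_prod_antisymmetrizer_vanish:
  assumes lam: "is_partition lam n" and inj: "inj_on T (diagram lam)"
    and jj: "j \<noteq> j'" "1 \<le> j" "col_len lam j' \<le> col_len lam j"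
    and y: "y \<in> col_entries lam T j'"
  shows "row_prod lam T (col_len lam 1) * (\<Prod>c\<leftarrow>cs. antisymmetrizer (col_entries lam T c)) *
    antisymmetrizer (insert y (col_entries lam T j)) = (0 :: 'k::field_char_0 group_alg)"
  using y
proof (induction cs arbitrary: y rule: rev_induct)
  case Nil
  then obtain i where i: "y = T (i, j')" "(i, j') \<in> diagram lam" by (auto simp: col_entries_def)
  then have ij: "(i, j) \<in> diagram lam"
    using jj diagram_col_iff[OF lam, of i] by auto
  let ?x = "T (i, j)"
  let ?A = "row_prod lam T (col_len lam 1) :: 'k group_alg"
  let ?b = "antisymmetrizer (insert y (col_entries lam T j)) :: 'k group_alg"
  have x: "?x \<in> col_entries lam T j" using ij by (auto simp: col_entries_def)
  have "?x \<noteq> y" using inj_onD[OF inj _ ij i(2)] i(1) jj(1) by auto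
  then have "?A * tr ?x y * ?b = - (?A * ?b)"
    using x by (simp add: mult.assoc tr_mult_antisymmetrizer)
  moreover have "?A * tr ?x y = ?A"
    unfolding i(1) using ij i(2) by (rule row_prod_mult_tr[OF lam inj])
  ultimately show ?case by (simp add: eq_uminus_self_iff)
next
  case (snoc c cs)
  let ?P = "row_prod lam T (col_len lam 1) * (\<Prod>c\<leftarrow>cs. antisymmetrizer (col_entries lam T c)) :: 'k group_alg"
  let ?b = "\<lambda>y. antisymmetrizer (insert y (col_entries lam T j)) :: 'k group_alg"
  have "?P * (perm_sign \<sigma> * ga_of \<sigma>) * ?b y = 0" if s: "\<sigma> \<in> sym_on (col_entries lam T c)" for \<sigma>
  proof -
    have stab: "Perm.apply \<sigma> z \<in> col_entries lam T i" if "z \<in> col_entries lam T i" for z i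
    proof (cases "i = c")
      case False
      then have "z \<notin> col_entries lam T c" using that col_entries_disjoint[OF inj False] by auto
      then show ?thesis using that in_sym_on_apply[OF s] by simp
    qed (use that sym_on_apply_in[OF s] in simp)
    have "Perm.apply \<sigma> ` col_entries lam T j = col_entries lam T j"
    proof (rule endo_inj_surj)
      show "finite (col_entries lam T j)" using finite_diagram[OF lam] by (simp add: col_entries_eq)
      show "inj_on (Perm.apply \<sigma>) (col_entries lam T j)" by (simp add: inj_on_def apply_inj)
    qed (use stab in auto)
    then have "ga_of \<sigma> * ?b y = ?b (Perm.apply \<sigma> y) * ga_of \<sigma>"
      by (simp add: ga_of_mult_antisymmetrizer)
    then have "?P * (perm_sign \<sigma> * ga_of \<sigma>) * ?b y = ?P * (perm_sign \<sigma> * (?b (Perm.apply \<sigma> y) * ga_of \<sigma>))"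
      by (simp add: mult.assoc)
    also have "\<dots> = perm_sign \<sigma> * (?P * ?b (Perm.apply \<sigma> y) * ga_of \<sigma>)"
      unfolding mult.assoc[symmetric] perm_sign_commute ..
    also have "?P * ?b (Perm.apply \<sigma> y) = 0"
      using stab[OF snoc.prems] by (rule snoc.IH)
    finally show ?thesis by simp
  qed
  then have "?P * antisymmetrizer (col_entries lam T c) * ?b y = 0"
    by (simp add: antisymmetrizer_eq[of "col_entries lam T c"] sum_distrib_left sum_distrib_right)
  then show ?case by (simp add: mult.assoc)
qed

text \<open>Only the lengths of the columns are compared, not their order, so between columns of
  equal length the relation holds in both directions, as the collapse of blocks requires.\<close>

lemma young_symmetrizer_garnir:
  assumes lam: "is_partition lam n" and inj: "inj_on T (diagram lam)"
    and jj: "j \<noteq> j'" "1 \<le> j" "col_len lam j' \<le> col_len lam j"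
  shows "garnir (young_symmetrizer lam T :: 'k::field_char_0 group_alg) (col_entries lam T j) (col_entries lam T j')"
  unfolding garnir_def
proof
  fix y assume y: "y \<in> col_entries lam T j'"
  let ?w = "young_symmetrizer lam T :: 'k group_alg"
  let ?C = "col_entries lam T j"
  have fin: "finite ?C" using finite_diagram[OF lam] by (simp add: col_entries_eq)
  have "y \<notin> ?C" using col_entries_disjoint[OF inj jj(1)] y by auto
  have "scal (fact (card ?C)) * (?w - ?w * trsum ?C y) = of_nat (fact (card ?C)) * ?w * (1 - trsum ?C y)"
    by (simp add: right_diff_distrib mult.assoc flip: scal_simps(3))
  also have "\<dots> = ?w * antisymmetrizer ?C * (1 - trsum ?C y)"
    unfolding alternates_antisymmetrizer[OF fin young_symmetrizer_alternates[OF lam inj]] ..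
  also have "\<dots> = ?w * antisymmetrizer (insert y ?C)"
    by (simp add: antisymmetrizer_insert[OF fin \<open>y \<notin> ?C\<close>] mult.assoc)
  also have "\<dots> = 0"
    unfolding young_symmetrizer_eq[OF lam order_refl order_refl] col_prod_def
    by (rule row_prod_antisymmetrizer_vanish[OF lam inj jj y])
  finally show "?w * trsum ?C y = ?w"
    using scal_cancel[of "fact (card ?C)" "?w - ?w * trsum ?C y" 0] by simp
qed

lemma col_len_antimono:
  assumes "is_partition lam n" "1 \<le> j" "j \<le> j'"
  shows "col_len lam j' \<le> col_len lam j"
  unfolding col_len_def
proof (rule card_mono)
  show "finite {i. (i, j) \<in> diagram lam}"
    unfolding col_rows[OF assms(1,2)] by simp
qed (use assms in \<open>auto simp: diagram_def\<close>)

lemma young_symmetrizer_specht_rel: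
  assumes "is_partition lam n" "inj_on T (diagram lam)"
  shows "specht_rel (young_symmetrizer lam T) (col_entries lam T)"
  unfolding specht_rel_def
  by (intro allI impI conjI young_symmetrizer_alternates[OF assms] young_symmetrizer_garnir[OF assms]
      col_len_antimono[OF assms(1)]) auto

section \<open>Blocks of columns\<close>

context young_corner
begin

text \<open>The right-to-left relations are assumed for \<open>w\<close> and transferred to
  \<open>w * corner_prod C v p a\<close>: the factors already present involve only \<open>a\<close>
  and columns outside the run. Equal lengths make the weights increase by 1.\<close>

lemma corner_prod_block:
  fixes w :: "'k::field_char_0 group_alg"
  assumes p: "v \<le> p" "Suc p \<le> t" and len: "\<And>c. Suc p \<le> c \<Longrightarrow> c \<le> t \<Longrightarrow> col_len lam c = h"
    and w: "\<And>c c'. Suc p \<le> c \<Longrightarrow> c < c' \<Longrightarrow> c' \<le> t \<Longrightarrow> garnir w (C c') (C c)"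
  shows "w * corner_prod C v t a =
    w * corner_prod C v p a * (1 - ga_scale (1 / corner_weight C v t) (\<Sum>c\<in>{Suc p..t}. trsum (C c) a))"
proof -
  let ?F = "\<lambda>c. factor (corner_weight C v c) (C c) a :: 'k group_alg"
  let ?w = "w * corner_prod C v p a"
  have "[Suc v..<Suc t] = [Suc v..<Suc p] @ [Suc p..<Suc t]"
    using p upt_add_eq_append[of "Suc v" "Suc p" "t - p"] by simp
  then have "w * corner_prod C v t a = ?w * prod_list (map ?F [Suc p..<Suc t])"
    by (simp only: corner_prod_def map_append prod_list.append mult.assoc)
  also have "\<dots> = ?w - scal (1 / corner_weight C v t) * (?w * (\<Sum>c = Suc p..t. trsum (C c) a))"
  proof (rule factors_collapse[OF p(2)])
    fix c c' assume c: "Suc p \<le> c" "c < c'" "c' \<le> t"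
    show "garnir ?w (C c') (C c)"
      unfolding corner_prod_def
    proof (rule garnir_mult[OF w[OF c] commutes_tr_factors])
      fix x y e assume "x \<in> C c'" "y \<in> C c" "e \<in> set [Suc v..<Suc p]"
      then show "x \<notin> insert a (C e) \<and> y \<notin> insert a (C e)"
        using notin_other[of x c' e] notin_other[of y c e] notin_other[of x c' v] notin_other[of y c v] c p a
        by auto
    qed
  next
    fix c assume c: "Suc p \<le> c" "c < t"
    then have "corner_weight C v (Suc c) - corner_weight C v c = (1 :: 'k)"
      using p len[of c] len[of "Suc c"] by (subst corner_weight_Suc) (auto simp: card_col_entries[OF inj])
    then show "corner_weight C v (Suc c) = corner_weight C v c + (1 :: 'k)"
      by (simp add: algebra_simps)
  next
    fix c assume "Suc p \<le> c"
    then show "corner_weight C v c \<noteq> (0 :: 'k)"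
      using p by (intro corner_weight_nonzero) simp
  qed (use p disj column_corner.a_notin[OF column_corner_axioms] in auto)
  also have "\<dots> = ?w * (1 - ga_scale (1 / corner_weight C v t) (\<Sum>c\<in>{Suc p..t}. trsum (C c) a))"
    by (simp add: ga_scale_eq right_diff_distrib scal_left_commute)
  finally show ?thesis .
qed

end

text \<open>The runs containing c are finitely many and include {c}. A maximal one among them is
  maximal among all runs, since any larger run also contains c.\<close>

lemma block_exists:
  assumes "c \<in> {1..mu 1}"
  obtains B where "is_block mu B" "c \<in> B"
proof -
  let ?A = "{B. equal_run mu B \<and> c \<in> B}"
  have "finite ?A"
    by (rule finite_subset[of _ "Pow {1..mu 1}"]) (auto simp: equal_run_def)
  moreover have "{c} \<in> ?A"
    using assms by (auto simp: equal_run_def intro!: exI[of _ c])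
  ultimately obtain B where B: "B \<in> ?A" "\<And>B'. B' \<in> ?A \<Longrightarrow> B \<subseteq> B' \<Longrightarrow> B = B'"
    using finite_has_maximal2[of ?A "{c}"] by auto
  then have "is_block mu B" unfolding is_block_def by blast
  then show ?thesis using B(1) that by auto
qed

lemma blocks_equal_run:
  assumes "blocks_left_to_right mu m B" "i \<in> {1..m}"
  shows "equal_run mu (B i)"
proof -
  have "B i \<in> B ` {1..m}" using assms(2) by (rule imageI)
  then show ?thesis using assms(1) by (simp add: blocks_left_to_right_def is_block_def)
qed

lemma equal_run_subset: "equal_run mu B \<Longrightarrow> B \<subseteq> {1..mu 1}"
  by (auto simp: equal_run_def)

text \<open>A column to the left of one in block i lies in some block, and the order of the blocks
  rules out an index above i. So the first s blocks fill an initial segment, whose length is their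
  total size.\<close>

lemma blocks_union:
  assumes B: "blocks_left_to_right mu m B" and s: "s \<le> m"
  shows "(\<Union>i\<in>{1..s}. B i) = {1..(\<Sum>i = 1..s. card (B i))}"
proof -
  have sub: "B i \<subseteq> {1..mu 1}" if "i \<in> {1..m}" for i
    using B that by (intro equal_run_subset blocks_equal_run)
  have less: "c < d" if "i \<in> {1..m}" "j \<in> {1..m}" "i < j" "c \<in> B i" "d \<in> B j" for i j c d
    using B that unfolding blocks_left_to_right_def by blast
  let ?U = "\<Union>i\<in>{1..s}. B i"
  have fin: "finite (B i)" if "i \<in> {1..s}" for i
    using sub[of i] s that by (auto intro: finite_subset)
  have "card ?U = (\<Sum>i = 1..s. card (B i))"
  proof (rule card_UN_disjoint)
    show "\<forall>i\<in>{1..s}. \<forall>j\<in>{1..s}. i \<noteq> j \<longrightarrow> B i \<inter> B j = {}"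
    proof (intro ballI impI)
      fix i j assume ij: "i \<in> {1..s}" "j \<in> {1..s}" "i \<noteq> j"
      then have m: "i \<in> {1..m}" "j \<in> {1..m}" using s by auto
      show "B i \<inter> B j = {}"
      proof (rule equals0I)
        fix c assume "c \<in> B i \<inter> B j"
        then show False
          using less[OF m, of c c] less[OF m(2,1), of c c] ij(3) by (cases i j rule: linorder_cases) auto
      qed
    qed
  qed (use fin in auto)
  moreover have "?U = {1..card ?U}"
  proof (rule initial_segment)
    show "0 \<notin> ?U"
    proof
      assume "0 \<in> ?U"
      then obtain i where "i \<in> {1..s}" "0 \<in> B i" by auto
      then show False using sub[of i] s by auto
    qed
    fix c d assume d: "d \<in> ?U" and c: "1 \<le> c" "c \<le> d"
    then obtain i where i: "i \<in> {1..s}" "d \<in> B i" by auto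
    then have "c \<in> {1..mu 1}" using sub[of i] s c by auto
    then obtain B' where "is_block mu B'" "c \<in> B'" by (rule block_exists)
    moreover from this have "B' \<in> B ` {1..m}"
      using B by (simp add: blocks_left_to_right_def)
    ultimately obtain j where j: "j \<in> {1..m}" "c \<in> B j" by auto
    have "j \<le> i"
      using less[of i j d c] i j s c by (cases "j \<le> i") auto
    then show "c \<in> ?U" using i j by auto
  qed (use fin in auto)
  ultimately show ?thesis by simp
qed

lemma blocks_total:
  assumes "blocks_left_to_right mu m B"
  shows "(\<Sum>i = 1..m. card (B i)) = mu 1"
proof -
  have "(\<Union>i\<in>{1..m}. B i) = {1..mu 1}"
  proof
    show "(\<Union>i\<in>{1..m}. B i) \<subseteq> {1..mu 1}"
      using assms by (intro UN_least equal_run_subset blocks_equal_run)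
    show "{1..mu 1} \<subseteq> (\<Union>i\<in>{1..m}. B i)"
    proof
      fix c assume "c \<in> {1..mu 1}"
      then obtain B' where "is_block mu B'" "c \<in> B'" by (rule block_exists)
      moreover from this have "B' \<in> B ` {1..m}"
        using assms by (simp add: blocks_left_to_right_def)
      ultimately show "c \<in> (\<Union>i\<in>{1..m}. B i)" by auto
    qed
  qed
  then have "{1..mu 1} = {1..(\<Sum>i = 1..m. card (B i))}"
    using blocks_union[OF assms order_refl] by simp
  then show ?thesis by (metis card_atLeastAtMost diff_Suc_1 One_nat_def)
qed

lemma block_interval:
  assumes B: "blocks_left_to_right mu m B" and s: "Suc s \<le> m"
  shows "B (Suc s) = {Suc (\<Sum>i = 1..s. card (B i))..(\<Sum>i = 1..Suc s. card (B i))}"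
    and "B (Suc s) \<noteq> {}"
proof -
  let ?q = "\<lambda>s. \<Sum>i = 1..s. card (B i)"
  have "equal_run mu (B (Suc s))"
    using B s by (intro blocks_equal_run) auto
  then show "B (Suc s) \<noteq> {}" by (auto simp: equal_run_def)
  have "(\<Union>i\<in>{1..s}. B i) \<inter> B (Suc s) = {}"
  proof -
    have "c < d" if "i \<in> {1..s}" "c \<in> B i" "d \<in> B (Suc s)" for i c d
    proof -
      have "i \<in> {1..m}" "Suc s \<in> {1..m}" "i < Suc s" using that s by auto
      then show ?thesis using B that unfolding blocks_left_to_right_def by blast
    qed
    then have "c \<notin> B (Suc s)" if "c \<in> (\<Union>i\<in>{1..s}. B i)" for c
      using that by blast
    then show ?thesis by (simp add: disjoint_iff)
  qed
  moreover have "(\<Union>i\<in>{1..Suc s}. B i) = (\<Union>i\<in>{1..s}. B i) \<union> B (Suc s)"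
    by (auto simp: atLeastAtMostSuc_conv)
  ultimately have "B (Suc s) = {1..?q (Suc s)} - {1..?q s}"
    using blocks_union[OF B s] blocks_union[OF B, of s] s by auto
  also have "{1..b} - {1..a} = {Suc a..b}" for a b :: nat by auto
  finally show "B (Suc s) = {Suc (?q s)..?q (Suc s)}" .
qed

section \<open>From blocks of the truncated tableau to columns\<close>

theorem theorem1p2:
  fixes n k u v a m :: nat
    and lam mu mut :: "nat \<Rightarrow> nat"
    and T S St :: tableau
    and B :: "nat \<Rightarrow> nat set"
    and l h :: "nat \<Rightarrow> nat"
    and r :: "nat \<Rightarrow> 'k::field_char_0"
    and x :: "nat \<Rightarrow> 'k group_alg"
  assumes "n = k + 1"
    and "is_partition lam n"
    and "is_partition mu k"
    and "diagram mu \<subseteq> diagram lam"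
    and "is_tableau lam {1..n} T"
    and "S = subtableau mu T"
    and "T ` diagram lam - S ` diagram mu = {a}"
    and "(u, v) \<in> diagram lam" and "T (u, v) = a"
    and "mut = drop_cols_shape v mu"
    and "St = drop_cols v mu S"
    and "blocks_left_to_right mut m B"
    and "\<And>i. i \<in> {1..m} \<Longrightarrow> l i = card (B i)"
    and "\<And>i c. i \<in> {1..m} \<Longrightarrow> c \<in> B i \<Longrightarrow> h i = col_len mut c"
    and "\<And>i. i \<in> {1..m} \<Longrightarrow>
           r i = of_nat (\<Sum>p = 1..i. l p) + of_nat u - of_nat (h i)"
    and "\<And>i. i \<in> {1..m} \<Longrightarrow>
           x i = (\<Sum>b\<in>block_entries mut St (B i). ga_of (Perm.swap a b))"
  shows "young_symmetrizer lam T * young_symmetrizer mu S =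
         young_symmetrizer lam T * of_nat (hook_product mu) *
           (\<Prod>i\<leftarrow>[1..<Suc m]. 1 - ga_scale (1 / r i) (x i))"
proof -
  have inj: "inj_on T (diagram lam)"
    using assms(5) by (simp add: is_tableau_def bij_betw_def)
  have S: "S p = T p" if "p \<in> diagram mu" for p
    using that by (simp add: assms(6) subtableau_def)
  have TS: "T ` diagram lam - T ` diagram mu = {a}"
    using assms(7) S by (simp cong: image_cong)
  have new: "(u, v) \<notin> diagram mu"
    using TS assms(9) by auto
  have "p = (u, v)" if p: "p \<in> diagram lam - diagram mu" for p
  proof -
    have "T p \<notin> T ` diagram mu"
      using inj_on_image_mem_iff[OF inj, of p "diagram mu"] p assms(4) by auto
    then have "T p = T (u, v)" using TS p assms(9) by auto
    then show ?thesis using inj_onD[OF inj] p assms(8) by auto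
  qed
  then have "diagram lam = insert (u, v) (diagram mu)"
    using assms(4,8) by auto
  then interpret young_corner lam mu n k u v T
    using assms(2,3) new inj by unfold_locales auto
  let ?w = "young_symmetrizer lam T :: 'k group_alg"
  define q where "q s = (\<Sum>i = 1..s. card (B i))" for s
  note Ta = assms(9)
  have w: "specht_rel ?w C"
    using lam inj by (rule young_symmetrizer_specht_rel)
  have YS: "young_symmetrizer mu S = (young_symmetrizer mu T :: 'k group_alg)"
  proof -
    have "row_entries mu S i = row_entries mu T i" "col_entries mu S i = col_entries mu T i" for i
      using S by (auto simp: row_entries_def col_entries_def) metis+
    then show ?thesis by (simp add: young_symmetrizer_def)
  qed
  have mut: "mut i = mu i - v" for i
    by (simp add: assms(10) drop_cols_shape_def)
  have mut_diag: "(i, c) \<in> diagram mut \<longleftrightarrow> 1 \<le> c \<and> (i, c + v) \<in> diagram mu" for i c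
    by (auto simp: diagram_def mut)
  \<comment> \<open>The corner lies in column v, so strictly to its right \<open>lam\<close> and
    \<open>mu\<close> have the same columns.\<close>
  have mut_len: "col_len mut c = col_len lam (c + v)" if "1 \<le> c" for c
    using that diag by (simp add: col_len_def mut_diag)
  have mut_col: "col_entries mut St c = C (c + v)" if "1 \<le> c" for c
  proof -
    have "St (i, c) = T (i, c + v)" if "(i, c) \<in> diagram mut" for i
      using that mut_diag[of i c] S by (simp add: assms(10,11) drop_cols_def)
    then have "col_entries mut St c = {T (i, c + v) |i. (i, c + v) \<in> diagram mu}"
      using mut_diag that unfolding col_entries_def by (metis (lifting))
    then show ?thesis using that diag by (auto simp: col_entries_def)
  qed
  \<comment> \<open>For u = 1 the first row of \<open>mu\<close> has length v - 1, and the truncated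
    subtraction gives \<open>mut 1 = 0\<close>; there are no blocks, and lam 1 = v.\<close>
  have total: "v + q m = lam 1"
  proof -
    have "v + mut 1 = lam 1"
      using mut[of 1] mu_u mu_other[of 1] lam_u is_partition_antimono[OF lam, of 1 u] uv by (cases "u = 1") auto
    then show ?thesis using blocks_total[OF assms(12)] by (simp add: q_def)
  qed
  \<comment> \<open>Induction over blocks: the first s block factors match the column factors up to
    column v + q s, where block s ends in the original numbering.\<close>
  have prod: "?w * (\<Prod>i\<leftarrow>[1..<Suc s]. 1 - ga_scale (1 / r i) (x i)) = ?w * corner_prod C v (v + q s) a"
    if "s \<le> m" for s
    using that
  proof (induction s)
    case 0
    then show ?case by (simp add: corner_prod_def q_def)
  next
    case (Suc s)
    then have s: "Suc s \<le> m" "Suc s \<in> {1..m}" by auto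
    note block = block_interval[OF assms(12) s(1), folded q_def]
    let ?p = "v + q s" and ?t = "v + q (Suc s)"
    have "q s < q (Suc s)" using block by auto
    then have pt: "v \<le> ?p" "Suc ?p \<le> ?t" by auto
    have shift: "bij_betw (\<lambda>c. c + v) (B (Suc s)) {Suc ?p..?t}"
      unfolding block(1)
      by (rule bij_betw_byWitness[where f'="\<lambda>c. c - v"]) auto
    have len: "col_len lam c = h (Suc s)" if "Suc ?p \<le> c" "c \<le> ?t" for c
    proof -
      have c: "c - v \<in> B (Suc s)" "1 \<le> c - v" "c - v + v = c" using that unfolding block(1) by auto
      show ?thesis using assms(14)[OF s(2) c(1)] mut_len[OF c(2)] c(3) by simp
    qed
    \<comment> \<open>The given r is the weight of the last column of the block: its column index
      minus v is q (Suc s), and its length is h (Suc s).\<close>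
    have r: "r (Suc s) = corner_weight C v ?t"
    proof -
      have "(\<Sum>p = 1..Suc s. l p) = q (Suc s)"
        unfolding q_def using s by (intro sum.cong refl assms(13)) auto
      then show ?thesis
        using len[of ?t] pt by (simp add: assms(15)[OF s(2)] corner_weight_eq)
    qed
    have "x (Suc s) = (\<Sum>c\<in>{Suc ?p..?t}. trsum (C c) a)"
    proof -
      have "block_entries mut St (B (Suc s)) = (\<Union>c\<in>{Suc ?p..?t}. C c)"
        unfolding block_entries_def bij_betw_imp_surj_on[OF shift, symmetric] image_image
        by (intro SUP_cong refl mut_col) (auto simp: block(1))
      then have "x (Suc s) = (\<Sum>b\<in>(\<Union>c\<in>{Suc ?p..?t}. C c). tr b a)"
        by (simp add: assms(16)[OF s(2)] tr_def swap_sym)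
      also have "\<dots> = (\<Sum>c\<in>{Suc ?p..?t}. trsum (C c) a)"
        unfolding trsum_def using fin disj by (intro sum.UNION_disjoint) auto
      finally show ?thesis .
    qed
    moreover have "?w * corner_prod C v ?t a = ?w * corner_prod C v ?p a *
        (1 - ga_scale (1 / corner_weight C v ?t) (\<Sum>c\<in>{Suc ?p..?t}. trsum (C c) a))"
      unfolding Ta[symmetric] using pt len
    proof (rule corner_prod_block)
      fix c c' assume c: "Suc ?p \<le> c" "c < c'" "c' \<le> ?t"
      then show "garnir ?w (C c') (C c)"
        using len[of c] len[of c'] by (intro young_symmetrizer_garnir[OF lam inj]) auto
    qed
    moreover have "?w * (\<Prod>i\<leftarrow>[1..<Suc s]. 1 - ga_scale (1 / r i) (x i)) = ?w * corner_prod C v ?p a"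
      using Suc by simp
    ultimately show ?case
      unfolding r[symmetric] by (simp flip: mult.assoc)
  qed
  have rel: "specht_rel (?w * corner_prod C v (lam 1) a) (col_entries mu T)"
    unfolding col_mu Ta[symmetric] using w col_entries_empty[OF lam] by (rule corner_prod_relations)
  have "?w * young_symmetrizer mu S = ?w * corner_prod C v (lam 1) a * young_symmetrizer mu T"
    unfolding YS Ta[symmetric] using corner_prod_absorb[OF w] by simp
  also have "\<dots> = of_nat (hook_product mu) * (?w * corner_prod C v (lam 1) a)"
    using mu inj_mu rel by (rule specht_rel_mult_young_symmetrizer)
  also have "\<dots> = ?w * of_nat (hook_product mu) * (\<Prod>i\<leftarrow>[1..<Suc m]. 1 - ga_scale (1 / r i) (x i))"
    unfolding total[symmetric] prod[OF order_refl, symmetric]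
    by (simp only: mult_of_nat_commute mult.assoc[symmetric])
  finally show ?thesis .
qed

end
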